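(* Let $X$ be a metric continuum. Then there exist a one-dimensional hereditarily indecomposable continuum $Y$ of countable weight (i.e.\ $Y$ is metrizable) and a continuous surjection $\pi:Y\to X$ that is weakly confluent.
   Context: A continuum is a compact connected Hausdorff space. A continuum is decomposable if it is the union of two proper subcontinua and indecomposable otherwise; it is hereditarily indecomposable if every subcontinuum is indecomposable (equivalently, of any two subcontinua that meet, one contains the other). A continuous surjection $\pi:Y\to X$ between continua is weakly confluent if every subcontinuum $K$ of $X$ is the image $\pi[K']$ of some subcontinuum $K'$ of $Y$. "One-dimensional" refers to covering dimension $1$. *)

theory Defs
  imports "HOL-Analysis.Analysis"
begin

definition continuum :: "'a topology \<Rightarrow> bool" where
  "continuum X \<longleftrightarrow> compact_space X \<and> connected_space X \<and> Hausdorff_space X \<and> topspace X \<noteq> {}"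

definition subcontinuum :: "'a topology \<Rightarrow> 'a set \<Rightarrow> bool" where
  "subcontinuum X K \<longleftrightarrow> K \<subseteq> topspace X \<and> continuum (subtopology X K)"

definition decomposable :: "'a topology \<Rightarrow> bool" where
  "decomposable X \<longleftrightarrow> continuum X \<and>
     (\<exists>A B. subcontinuum X A \<and> subcontinuum X B \<and> A \<noteq> topspace X \<and> B \<noteq> topspace X
            \<and> A \<union> B = topspace X)"

definition indecomposable :: "'a topology \<Rightarrow> bool" where
  "indecomposable X \<longleftrightarrow> continuum X \<and> \<not> decomposable X"

definition hereditarily_indecomposable :: "'a topology \<Rightarrow> bool" where
  "hereditarily_indecomposable X \<longleftrightarrow> continuum X \<and>
     (\<forall>K. subcontinuum X K \<longrightarrow> indecomposable (subtopology X K))"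

definition covering_dim_le :: "'a topology \<Rightarrow> nat \<Rightarrow> bool" where
  "covering_dim_le X n \<longleftrightarrow>
     (\<forall>\<U>. finite \<U> \<and> (\<forall>U\<in>\<U>. openin X U) \<and> \<Union>\<U> = topspace X \<longrightarrow>
        (\<exists>\<V>. finite \<V> \<and> (\<forall>V\<in>\<V>. openin X V) \<and> \<Union>\<V> = topspace X \<and>
              (\<forall>V\<in>\<V>. \<exists>U\<in>\<U>. V \<subseteq> U) \<and>
              (\<forall>x\<in>topspace X. card {V\<in>\<V>. x \<in> V} \<le> n + 1)))"

definition one_dimensional :: "'a topology \<Rightarrow> bool" where
  "one_dimensional X \<longleftrightarrow> covering_dim_le X 1 \<and> \<not> covering_dim_le X 0"

definition weakly_confluent :: "'b topology \<Rightarrow> 'a topology \<Rightarrow> ('b \<Rightarrow> 'a) \<Rightarrow> bool" where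
  "weakly_confluent Y X \<pi> \<longleftrightarrow> continuous_map Y X \<pi> \<and> \<pi> ` topspace Y = topspace X \<and>
     (\<forall>K. subcontinuum X K \<longrightarrow> (\<exists>K'. subcontinuum Y K' \<and> \<pi> ` K' = K))"

end

theory Submission
  imports Defs
begin

text \<open>
  Embed \<open>X\<close> in the even coordinates of the Hilbert cube. The continuum \<open>Y\<close> is the intersection of a decreasing
  sequence of continua \<open>S\<^sub>n\<close>, each of which is a cylinder over all but finitely many odd coordinates; step \<open>n\<close>
  ties three of these coordinates to the earlier ones, once to fold and once to lower the dimension.

  Folding. Given \<open>g : S \<rightarrow> [0,1]\<close>, require \<open>g y = h (y\<^sub>m)\<close> for a Z-shaped \<open>h\<close>. This equation cuts the bottom
  \<open>y\<^sub>m = 0\<close> of \<open>S\<close> from the top \<open>y\<^sub>m = 1\<close>, and then already a connected piece of its solution set does: a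
  disjoint union of two closed sets cuts only if one of them does, by lifting circle-valued maps along the
  coordinate \<open>y\<^sub>m\<close>. A cutting set also cuts the cylinder over any subcontinuum, so that the same lemma yields weak
  confluence. Folding at countably many functions \<open>g\<close> makes \<open>Y\<close> hereditarily indecomposable (this is the
  Krasinkiewicz-Minc criterion).

  Dimension. Given a closed cover \<open>A\<^sub>1, \<dots>, A\<^sub>k\<close> of \<open>S\<close>, replace \<open>S\<close> by the union of the \<open>A\<^sub>i \<times> \<ell>\<^sub>i\<close>, where the
  \<open>\<ell>\<^sub>i\<close> are segments of lines in general position. Any two lines meet, so the projection to \<open>S\<close> is monotone, and
  no three do, so the cover acquires a refinement of order two.
\<close>

section \<open>Sets cutting the bottom of a product from its top\<close>

text \<open>Uniform continuity lets [0,1] be cut into \<open>n\<close> pieces so short that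
  quotients of consecutive values of \<open>w\<close> along a vertical segment lie in the right
  half-plane, where \<open>Ln\<close> is continuous. Adding up their arguments from the bottom gives
  the lift.\<close>

lemma circle_map_lift:
  fixes K :: "'a::metric_space set" and w :: "'a \<times> real \<Rightarrow> complex"
  assumes K: "compact K" and w: "continuous_on (K \<times> {0..1}) w"
    and norm_w: "\<And>z. z \<in> K \<times> {0..1} \<Longrightarrow> norm (w z) = 1"
    and w0: "\<And>x. x \<in> K \<Longrightarrow> w (x, 0) = 1"
  obtains v where "continuous_on (K \<times> {0..1}) v"
    and "\<And>z. z \<in> K \<times> {0..1} \<Longrightarrow> w z = cis (2 * pi * v z)"
    and "\<And>x. x \<in> K \<Longrightarrow> v (x, 0) = 0"
proof -
  have "uniformly_continuous_on (K \<times> {0..1}) w"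
    using K w by (intro compact_uniformly_continuous compact_Times) auto
  then obtain d where d: "d > 0"
    and dw: "\<And>a b. \<lbrakk>a \<in> K \<times> {0..1}; b \<in> K \<times> {0..1}; dist b a < d\<rbrakk> \<Longrightarrow> dist (w b) (w a) < 1"
    unfolding uniformly_continuous_on_def by (meson zero_less_one)
  obtain n where n: "n > 0" "inverse (real n) < d"
    using d ex_inverse_of_nat_less by blast
  \<comment> \<open>Truncation at height \<open>i / n\<close>. On [0,1], \<open>c 0\<close> is 0 and
    \<open>c n\<close> is the identity, so the product of the \<open>q i\<close> telescopes from
    \<open>w (x, 0) = 1\<close> to \<open>w z\<close>.\<close>
  define c where "c i t = min t (real i / real n)" for i t
  define q where "q i z = w (fst z, c (Suc i) (snd z)) / w (fst z, c i (snd z))" for i and z :: "'a \<times> real"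
  define v where "v z = (\<Sum>i<n. Im (Ln (q i z))) / (2 * pi)" for z
  have c_mem: "(fst z, c i (snd z)) \<in> K \<times> {0..1}" if "z \<in> K \<times> {0..1}" for i z
    using that n by (auto simp: c_def)
  have cont: "continuous_on (K \<times> {0..1}) (\<lambda>z. w (fst z, c i (snd z)))" for i
    using c_mem by (intro continuous_on_compose2[OF w]) (auto simp: c_def intro!: continuous_intros)
  have norm_c: "norm (w (fst z, c i (snd z))) = 1" if "z \<in> K \<times> {0..1}" for i z
    using c_mem[OF that] norm_w by blast
  have norm_q: "norm (q i z) = 1" if "z \<in> K \<times> {0..1}" for i z
    using norm_c[OF that] by (simp add: q_def norm_divide)
  have Re_q: "Re (q i z) > 0" if z: "z \<in> K \<times> {0..1}" for i z
  proof -
    have "\<bar>c (Suc i) (snd z) - c i (snd z)\<bar> \<le> inverse (real n)"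
      using n(1) by (auto simp: c_def min_def field_simps)
    then have "dist (fst z, c (Suc i) (snd z)) (fst z, c i (snd z)) < d"
      using n by (simp add: dist_prod_def dist_real_def)
    then have "norm (w (fst z, c (Suc i) (snd z)) - w (fst z, c i (snd z))) < 1"
      using dw c_mem[OF z] by (metis dist_norm)
    moreover have "q i z - 1 = (w (fst z, c (Suc i) (snd z)) - w (fst z, c i (snd z))) / w (fst z, c i (snd z))"
      using norm_c[OF z, of i] by (auto simp: q_def diff_divide_distrib)
    ultimately have "norm (q i z - 1) < 1"
      using norm_c[OF z, of i] by (simp add: norm_divide)
    then show ?thesis
      using abs_Re_le_cmod[of "q i z - 1"] by auto
  qed
  show thesis
  proof
    have "continuous_on (K \<times> {0..1}) (\<lambda>z. Ln (q i z))" for i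
    proof (rule continuous_on_Ln')
      show "continuous_on (K \<times> {0..1}) (q i)"
        unfolding q_def by (intro continuous_intros cont) (metis norm_c norm_zero zero_neq_one)
      show "q i z \<notin> \<real>\<^sub>\<le>\<^sub>0" if "z \<in> K \<times> {0..1}" for z
        using Re_q[OF that, of i] by (auto simp: complex_nonpos_Reals_iff)
    qed
    then show "continuous_on (K \<times> {0..1}) v"
      unfolding v_def by (intro continuous_on_divide continuous_on_sum continuous_on_Im continuous_on_const) auto
    show "v (x, 0) = 0" if "x \<in> K" for x
      using w0[OF that] by (simp add: v_def q_def c_def)
    show "w z = cis (2 * pi * v z)" if z: "z \<in> K \<times> {0..1}" for z
    proof -
      have cis_q: "cis (Im (Ln (q i z))) = q i z" for i
      proof -
        have "q i z \<noteq> 0" using norm_q[OF z, of i] by auto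
        then show ?thesis
          using norm_q[OF z, of i] exp_eq_polar[of "Ln (q i z)"] by (simp add: Re_Ln)
      qed
      have telescope: "(\<Prod>i<k. q i z) = w (fst z, c k (snd z)) / w (fst z, c 0 (snd z))" for k
      proof (induction k)
        case 0 then show ?case using norm_c[OF z, of 0] by auto
      next
        case (Suc k) then show ?case using norm_c[OF z, of k] by (auto simp: q_def)
      qed
      have "cis (\<Sum>i<k. f i) = (\<Prod>i<k. cis (f i))" for k and f :: "nat \<Rightarrow> real"
        by (induction k) (simp_all add: cis_mult [symmetric])
      with cis_q have "cis (2 * pi * v z) = (\<Prod>i<n. q i z)"
        by (simp add: v_def)
      also have "\<dots> = w (fst z, c n (snd z)) / w (fst z, c 0 (snd z))"
        by (rule telescope)
      also have "\<dots> = w z"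
        using z n w0 by (cases z) (auto simp: c_def min_def)
      finally show ?thesis by simp
    qed
  qed
qed

definition continuum_joins :: "'a::metric_space set \<Rightarrow> ('a \<times> real) set \<Rightarrow> bool" where
  "continuum_joins K D \<longleftrightarrow> D \<subseteq> K \<times> {0..1} \<and> compact D \<and> connected D \<and>
     (\<exists>x. (x, 0) \<in> D) \<and> (\<exists>x. (x, 1) \<in> D)"

text \<open>Cutting is tested on continua only. For compact \<open>Z\<close>,
  \<open>compact_separation\<close> turns this into a separation of the complement of a
  neighbourhood of \<open>Z\<close>.\<close>

definition cuts :: "'a::metric_space set \<Rightarrow> ('a \<times> real) set \<Rightarrow> bool" where
  "cuts K Z \<longleftrightarrow> (\<forall>D. continuum_joins K D \<longrightarrow> D \<inter> Z \<noteq> {})"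

section \<open>Integer-valued functions, separation of closed sets, localized circle maps\<close>

lemma connected_Ints_valued_constant:
  fixes f :: "'a::topological_space \<Rightarrow> real"
  assumes "connected S" "continuous_on S f" "\<And>x. x \<in> S \<Longrightarrow> f x \<in> \<int>" "a \<in> S" "b \<in> S"
  shows "f a = f b"
proof -
  have conn: "connected (f ` S)"
    by (rule connected_continuous_image) fact+
  have "False" if "f x < f y" "x \<in> S" "y \<in> S" for x y
  proof -
    obtain m n where mn: "f x = of_int m" "f y = of_int n"
      using assms(3) \<open>x \<in> S\<close> \<open>y \<in> S\<close> by (metis Ints_cases)
    then have "m + 1 \<le> n"
      using \<open>f x < f y\<close> by simp
    then have "real_of_int (m + 1) \<le> real_of_int n"
      by (simp only: of_int_le_iff)
    then have "f x + 1/2 \<le> f y"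
      using mn by simp
    then have "f x + 1/2 \<in> f ` S"
      by (rule connectedD_interval[OF conn imageI[OF \<open>x \<in> S\<close>] imageI[OF \<open>y \<in> S\<close>], rotated]) simp
    then have "f x + 1/2 \<in> \<int>"
      using assms(3) by auto
    then have "(f x + 1/2) - f x \<in> \<int>"
      using assms(3) \<open>x \<in> S\<close> by (intro Ints_diff)
    then obtain k where "(1/2::real) = of_int k"
      by (auto elim: Ints_cases)
    then have "(1::real) = of_int (2 * k)" by simp
    then have "1 = 2 * k" by linarith
    then show False by presburger
  qed
  then show ?thesis
    using assms(4,5) by (metis linorder_neqE_linordered_idom)
qed

text \<open>The closure of a connected subset of \<open>S\<close> is a continuum in
  \<open>S\<close>, so the hypothesis on continua extends to all connected sets, as the cut wire
  fence theorem demands.\<close>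

lemma compact_separation:
  fixes S :: "'a::metric_space set"
  assumes "compact S" "closedin (top_of_set S) A" "closedin (top_of_set S) B"
    and "\<And>C. \<lbrakk>compact C; connected C; C \<subseteq> S; C \<inter> A \<noteq> {}\<rbrakk> \<Longrightarrow> C \<inter> B = {}"
  obtains U V where "compact U" "compact V" "U \<union> V = S" "U \<inter> V = {}" "A \<subseteq> U" "B \<subseteq> V"
proof -
  have "separated_between (top_of_set S) A B"
  proof (rule cut_wire_fence_theorem)
    show "disjnt C A \<or> disjnt C B" if "connectedin (top_of_set S) C" for C
    proof -
      have C: "connected C" "C \<subseteq> S"
        using that by (auto simp: connectedin_subtopology)
      have "closure C \<subseteq> S"
        using C assms(1) by (simp add: closure_minimal compact_imp_closed)
      then have "compact (closure C)"
        using assms(1) by (metis closed_closure closed_Int_compact inf.absorb_iff1)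
      then have "closure C \<inter> A \<noteq> {} \<Longrightarrow> closure C \<inter> B = {}"
        using \<open>closure C \<subseteq> S\<close> C connected_imp_connected_closure assms(4) by blast
      then show ?thesis
        using closure_subset[of C] by (auto simp: disjnt_def)
    qed
  qed (use assms in \<open>auto simp: compact_space_subtopology metrizable_imp_Hausdorff_space metrizable_space_subtopology metrizable_space_euclidean\<close>)
  then obtain U V where "closedin (top_of_set S) U" "closedin (top_of_set S) V" "U \<union> V = S" "disjnt U V"
    "A \<subseteq> U" "B \<subseteq> V"
    unfolding separated_between_alt by auto
  then show thesis
    using that[of U V] assms(1) closedin_compact[of S] by (simp add: disjnt_def)
qed

lemma continuous_separating_function:
  fixes A B :: "'a::metric_space set"
  assumes "closed A" "closed B" "A \<inter> B = {}" "A \<noteq> {}" "B \<noteq> {}"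
  obtains u :: "'a \<Rightarrow> real" where "continuous_on UNIV u" "\<And>x. x \<in> A \<Longrightarrow> u x = 0" "\<And>x. x \<in> B \<Longrightarrow> u x = 1"
proof
  have "infdist x A + infdist x B \<noteq> 0" for x
    using assms infdist_nonneg[of x A] infdist_nonneg[of x B] in_closed_iff_infdist_zero[of A x] in_closed_iff_infdist_zero[of B x]
    by (metis IntI add_nonneg_eq_0_iff empty_iff)
  then show "continuous_on UNIV (\<lambda>x. infdist x A / (infdist x A + infdist x B))"
    by (intro continuous_intros) auto
  show "infdist x A / (infdist x A + infdist x B) = 1" if "x \<in> B" for x
    using that \<open>\<And>x. infdist x A + infdist x B \<noteq> 0\<close>[of x] by simp
qed auto

lemma compact_infdist_gap:
  fixes A B :: "'a::metric_space set"
  assumes "compact A" "compact B" "A \<inter> B = {}" "A \<noteq> {}"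
  obtains e where "e > 0" "\<And>x. x \<in> B \<Longrightarrow> e < infdist x A"
proof (cases "B = {}")
  case True
  with that[of 1] show thesis by auto
next
  case False
  have "continuous_on B (\<lambda>x. infdist x A)"
    by (intro continuous_intros)
  then obtain b where b: "b \<in> B" "\<And>x. x \<in> B \<Longrightarrow> infdist b A \<le> infdist x A"
    using continuous_attains_inf[of B "\<lambda>x. infdist x A"] assms False by auto
  have "infdist b A > 0"
    using b assms in_closed_iff_infdist_zero[of A b] infdist_nonneg[of b A] compact_imp_closed[of A]
    by (metis IntI empty_iff le_less)
  with b that[of "infdist b A / 2"] show thesis by force
qed

text \<open>On the level \<open>d z = e\<close> the angle is an integer multiple of 2 pi, so both
  branches equal 1 there. This localizes a circle map to the set where \<open>d\<close> is
  small.\<close>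

lemma bump_circle_map:
  fixes u d :: "'a::topological_space \<Rightarrow> real"
  assumes "continuous_on T u" "continuous_on T d"
    and "\<And>z. \<lbrakk>z \<in> T; d z = e\<rbrakk> \<Longrightarrow> u z \<in> \<int>"
  shows "continuous_on T (\<lambda>z. if d z \<le> e then cis (2 * pi * u z) else 1)"
proof (rule continuous_on_cases_le[OF _ _ assms(2)])
  show "continuous_on {z \<in> T. d z \<le> e} (\<lambda>z. cis (2 * pi * u z))"
    by (intro continuous_intros continuous_on_subset[OF assms(1)]) auto
qed (auto simp: assms(3) cis_multiple_2pi)

text \<open>Let \<open>u\<close> be \<open>0\<close> at the bottom, \<open>1\<close> at the top and locally constant away from \<open>Z1 \<union> Z2\<close>. Splitting
  \<open>exp (2 \<pi> i u)\<close> into factors supported near \<open>Z1\<close> and \<open>Z2\<close> and lifting each gives \<open>u = v1 + v2\<close>, but \<open>v1\<close>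
  vanishes at the top if \<open>Z1\<close> does not cut, and likewise \<open>v2\<close>.\<close>

lemma cuts_disjoint_Un:
  fixes K :: "'a::metric_space set"
  assumes K: "compact K" "connected K"
    and Z1: "compact Z1" "Z1 \<subseteq> K \<times> {0<..<1}" and Z2: "compact Z2" "Z2 \<subseteq> K \<times> {0<..<1}"
    and disj: "Z1 \<inter> Z2 = {}" and cut: "cuts K (Z1 \<union> Z2)"
  shows "cuts K Z1 \<or> cuts K Z2"
proof (rule ccontr)
  assume "\<not> ?thesis"
  then obtain D1 D2 where D1: "continuum_joins K D1" "D1 \<inter> Z1 = {}"
    and D2: "continuum_joins K D2" "D2 \<inter> Z2 = {}"
    by (auto simp: cuts_def)
  have ne: "Z1 \<noteq> {}" "Z2 \<noteq> {}"
    using D1 D2 cut by (auto simp: cuts_def)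
  let ?T = "K \<times> {0..1::real}"
  have compT: "compact ?T" and connT: "connected ?T"
    using K by (auto intro: compact_Times connected_Times)
  have D: "compact D1" "connected D1" "D1 \<subseteq> ?T" "compact D2" "connected D2" "D2 \<subseteq> ?T"
    using D1 D2 by (auto simp: continuum_joins_def)
  obtain a1 b1 a2 b2 where ab: "(a1,0) \<in> D1" "(b1,1) \<in> D1" "(a2,0) \<in> D2" "(b2,1) \<in> D2"
    using D1 D2 by (auto simp: continuum_joins_def)
  let ?bot = "K \<times> {0::real}" and ?top = "K \<times> {1::real}"
  have bt: "compact ?bot" "compact ?top"
    using K by (auto intro: compact_Times)
  obtain e1 where e1: "e1 > 0" "\<And>z. z \<in> Z2 \<union> D1 \<union> ?bot \<union> ?top \<Longrightarrow> e1 < infdist z Z1"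
    by (rule compact_infdist_gap[of Z1 "Z2 \<union> D1 \<union> ?bot \<union> ?top"])
       (use Z1 Z2 D D1 bt disj ne in \<open>auto intro!: compact_Un\<close>)
  \<comment> \<open>\<open>e2\<close> is chosen after \<open>e1\<close>, against the whole closed
    \<open>e1\<close>-neighbourhood of \<open>Z1\<close> in \<open>?T\<close>. No point of
    \<open>?T\<close> is therefore within both distances, and the maps \<open>w1\<close> and
    \<open>w2\<close> below never differ from 1 at once.\<close>
  obtain e2 where e2: "e2 > 0" "\<And>z. z \<in> {z \<in> ?T. infdist z Z1 \<le> e1} \<union> D2 \<union> ?bot \<union> ?top \<Longrightarrow> e2 < infdist z Z2"
  proof (rule compact_infdist_gap[of Z2 "{z \<in> ?T. infdist z Z1 \<le> e1} \<union> D2 \<union> ?bot \<union> ?top"])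
    have "{z \<in> ?T. infdist z Z1 \<le> e1} = ?T \<inter> {z. infdist z Z1 \<le> e1}" by auto
    moreover have "closed {z. infdist z Z1 \<le> e1}"
      by (intro closed_Collect_le continuous_intros)
    ultimately have "compact {z \<in> ?T. infdist z Z1 \<le> e1}"
      using compT by (metis compact_Int_closed)
    then show "compact ({z \<in> ?T. infdist z Z1 \<le> e1} \<union> D2 \<union> ?bot \<union> ?top)"
      using D bt by (intro compact_Un)
    have "infdist z Z1 > e1" if "z \<in> Z2" for z
      using e1(2) that by blast
    then show "Z2 \<inter> ({z \<in> ?T. infdist z Z1 \<le> e1} \<union> D2 \<union> ?bot \<union> ?top) = {}"
      using D2(2) Z2(2) by fastforce
  qed (use Z2 ne in auto)
  define N where "N = {z. infdist z Z1 < e1} \<union> {z. infdist z Z2 < e2}"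
  have "open N"
    unfolding N_def by (intro open_Un open_Collect_less continuous_intros)
  have ZN: "Z1 \<union> Z2 \<subseteq> N"
    using e1 e2 by (auto simp: N_def)
  have btN: "?bot \<inter> N = {}" "?top \<inter> N = {}"
  proof -
    have "z \<notin> N" if "z \<in> ?bot \<union> ?top" for z
    proof -
      have "e1 < infdist z Z1" "e2 < infdist z Z2"
        using e1(2) e2(2) that by blast+
      then show ?thesis by (simp add: N_def)
    qed
    then show "?bot \<inter> N = {}" "?top \<inter> N = {}" by blast+
  qed
  \<comment> \<open>A continuum outside \<open>N\<close> from bottom to top would miss
    \<open>Z1 \<union> Z2\<close>.\<close>
  obtain E0 E1 where E: "compact E0" "compact E1" "E0 \<union> E1 = ?T - N" "E0 \<inter> E1 = {}" "?bot \<subseteq> E0" "?top \<subseteq> E1"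
  proof (rule compact_separation[of "?T - N" ?bot ?top])
    show "compact (?T - N)"
      using compT \<open>open N\<close> by (rule compact_diff)
    have "?bot \<subseteq> ?T" "?top \<subseteq> ?T" by auto
    then show "closedin (top_of_set (?T - N)) ?bot" "closedin (top_of_set (?T - N)) ?top"
      using btN by (intro closed_subset compact_imp_closed[OF bt(1)] compact_imp_closed[OF bt(2)]; blast)+
    show "C \<inter> ?top = {}" if C: "compact C" "connected C" "C \<subseteq> ?T - N" "C \<inter> ?bot \<noteq> {}" for C
    proof (rule ccontr)
      assume "C \<inter> ?top \<noteq> {}"
      then have "continuum_joins K C"
        unfolding continuum_joins_def using C by blast
      then show False
        using cut C(3) ZN unfolding cuts_def by blast
    qed
  qed
  obtain u where u: "continuous_on UNIV u" "\<And>z. z \<in> E0 \<Longrightarrow> u z = 0" "\<And>z. z \<in> E1 \<Longrightarrow> u z = (1::real)"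
    by (rule continuous_separating_function[of E0 E1])
       (use E(1,2,4) compact_imp_closed E(5,6) ab(1,2) D(3) in \<open>blast+\<close>)
  have u_T: "continuous_on ?T u"
    using u(1) continuous_on_subset by blast
  have u_int: "u z \<in> \<int>" if "z \<in> ?T" "z \<notin> N" for z
    using that E(3) u by (metis DiffI Ints_0 Ints_1 UnE)
  define w1 where "w1 z = (if infdist z Z1 \<le> e1 then cis (2 * pi * u z) else 1)" for z
  define w2 where "w2 z = (if infdist z Z2 \<le> e2 then cis (2 * pi * u z) else 1)" for z
  have w_cont: "continuous_on ?T w1" "continuous_on ?T w2"
  proof -
    have "u z \<in> \<int>" if "z \<in> ?T" "infdist z Z1 = e1" for z
      using u_int[OF that(1)] e2(2)[of z] that unfolding N_def by auto
    then show "continuous_on ?T w1"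
      unfolding w1_def by (intro bump_circle_map[OF u_T] continuous_intros) auto
    have "u z \<in> \<int>" if "z \<in> ?T" "infdist z Z2 = e2" for z
      using u_int[OF that(1)] e2(2)[of z] that unfolding N_def by fastforce
    then show "continuous_on ?T w2"
      unfolding w2_def by (intro bump_circle_map[OF u_T] continuous_intros) auto
  qed
  have ends: "w1 (x, 0) = 1" "w2 (x, 0) = 1" if "x \<in> K" for x
    using e1(2)[of "(x, 0)"] e2(2)[of "(x, 0)"] that by (simp_all add: w1_def w2_def)
  obtain v1 where v1: "continuous_on ?T v1" "\<And>z. z \<in> ?T \<Longrightarrow> w1 z = cis (2 * pi * v1 z)"
    "\<And>x. x \<in> K \<Longrightarrow> v1 (x, 0) = 0"
    by (rule circle_map_lift[OF K(1) w_cont(1)]) (auto simp: ends, simp add: w1_def)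
  obtain v2 where v2: "continuous_on ?T v2" "\<And>z. z \<in> ?T \<Longrightarrow> w2 z = cis (2 * pi * v2 z)"
    "\<And>x. x \<in> K \<Longrightarrow> v2 (x, 0) = 0"
    by (rule circle_map_lift[OF K(1) w_cont(2)]) (auto simp: ends, simp add: w2_def)
  have cis_int: "r \<in> \<int>" if "cis (2 * pi * r) = 1" for r
    using that by (auto simp: cis_conv_exp exp_eq_1)
  have int1: "v1 z \<in> \<int>" if "z \<in> ?T" "e1 < infdist z Z1" for z
    using cis_int v1(2)[OF that(1)] that by (simp add: w1_def)
  have int2: "v2 z \<in> \<int>" if "z \<in> ?T" "e2 < infdist z Z2" for z
    using cis_int v2(2)[OF that(1)] that by (simp add: w2_def)
  have top1: "v1 (b1, 1) = 0"
  proof -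
    have "v1 (b1, 1) = v1 (a1, 0)"
    proof (rule connected_Ints_valued_constant[of D1])
      show "continuous_on D1 v1"
        using v1(1) D(3) by (rule continuous_on_subset)
      show "v1 z \<in> \<int>" if "z \<in> D1" for z
        using that D(3) e1(2)[of z] by (intro int1) blast+
    qed (use D ab in blast)+
    moreover have "a1 \<in> K" using ab D(3) by blast
    ultimately show ?thesis using v1(3) by simp
  qed
  have top2: "v2 (b2, 1) = 0"
  proof -
    have "v2 (b2, 1) = v2 (a2, 0)"
    proof (rule connected_Ints_valued_constant[of D2])
      show "continuous_on D2 v2"
        using v2(1) D(6) by (rule continuous_on_subset)
      show "v2 z \<in> \<int>" if "z \<in> D2" for z
        using that D(6) e2(2)[of z] by (intro int2) blast+
    qed (use D ab in blast)+
    moreover have "a2 \<in> K" using ab D(6) by blast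
    ultimately show ?thesis using v2(3) by simp
  qed
  \<comment> \<open>\<open>top1\<close> and \<open>top2\<close> concern different points. The top is
    connected and \<open>v2\<close> is integer-valued on it, so both values can be taken at
    \<open>(b1, 1)\<close>.\<close>
  have "v2 (b1, 1) = v2 (b2, 1)"
  proof (rule connected_Ints_valued_constant[of ?top])
    show "connected ?top" using K by (intro connected_Times) auto
    show "continuous_on ?top v2" using v2(1) by (rule continuous_on_subset) auto
    show "v2 z \<in> \<int>" if "z \<in> ?top" for z
      using that e2(2)[of z] by (intro int2) auto
  qed (use ab D(3,6) in blast)+
  then have "v1 (b1, 1) + v2 (b1, 1) - u (b1, 1) = -1"
    using top1 top2 u(3)[of "(b1, 1)"] E(6) ab(2) D(3) by auto
  moreover have "v1 (a1, 0) + v2 (a1, 0) - u (a1, 0) = 0"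
  proof -
    have "(a1, 0) \<in> ?bot" using ab(1) D(3) by blast
    then show ?thesis
      using v1(3)[of a1] v2(3)[of a1] u(2)[of "(a1, 0)"] E(5) by auto
  qed
  \<comment> \<open>The identity \<open>w1 z * w2 z = cis (2 * pi * u z)\<close> holds on all of
    \<open>?T\<close>, so this difference is integer-valued on a connected set, against the values
    -1 at the top and 0 at the bottom.\<close>
  moreover have "v1 (b1, 1) + v2 (b1, 1) - u (b1, 1) = v1 (a1, 0) + v2 (a1, 0) - u (a1, 0)"
  proof (rule connected_Ints_valued_constant[OF connT])
    show "continuous_on ?T (\<lambda>z. v1 z + v2 z - u z)"
      by (intro continuous_intros v1 v2 u_T)
    show "v1 z + v2 z - u z \<in> \<int>" if z: "z \<in> ?T" for z
    proof (rule cis_int)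
      have "cis (2 * pi * (v1 z + v2 z - u z)) = w1 z * w2 z / cis (2 * pi * u z)"
        using v1(2)[OF z] v2(2)[OF z] by (simp add: cis_mult cis_divide algebra_simps)
      also have "\<dots> = 1"
      proof (cases "infdist z Z1 \<le> e1 \<or> infdist z Z2 \<le> e2")
        case True
        then show ?thesis using e2(2)[of z] z by (auto simp: w1_def w2_def)
      next
        case False
        then have "u z \<in> \<int>" using u_int z by (auto simp: N_def)
        with False show ?thesis by (simp add: w1_def w2_def cis_multiple_2pi)
      qed
      finally show "cis (2 * pi * (v1 z + v2 z - u z)) = 1" .
    qed
  qed (use ab D(3) in blast)+
  ultimately show False by simp
qed

lemma cuts_mono: "cuts K Z \<Longrightarrow> Z \<subseteq> Z' \<Longrightarrow> cuts K Z'"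
  unfolding cuts_def by blast

text \<open>If no component of \<open>Z\<close> cuts, each lies in a relatively clopen part
  \<open>U z\<close> that misses some joining continuum and so does not cut either. Finitely many
  such parts cover \<open>Z\<close>, and by \<open>cuts_disjoint_Un\<close> their union does not
  cut.\<close>

lemma cuts_connected_subset:
  fixes K :: "'a::metric_space set"
  assumes K: "compact K" "connected K"
    and Z: "compact Z" "Z \<subseteq> K \<times> {0<..<1}" and cut: "cuts K Z"
  obtains C where "C \<subseteq> Z" "compact C" "connected C" "cuts K C"
proof (rule ccontr)
  assume "\<not> thesis"
  with that have not_cut: "\<not> cuts K C" if "C \<subseteq> Z" "compact C" "connected C" for C
    using that by blast
  have "\<exists>U V. compact U \<and> compact V \<and> U \<union> V = Z \<and> U \<inter> V = {} \<and> z \<in> U \<and> \<not> cuts K U" if z: "z \<in> Z" for z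
  proof -
    let ?C = "connected_component_set Z z"
    have "compact ?C"
      using closedin_compact[OF Z(1) closedin_connected_component] .
    then have "\<not> cuts K ?C"
      by (intro not_cut) (auto simp: connected_component_subset)
    then obtain D where D: "continuum_joins K D" "D \<inter> ?C = {}"
      by (auto simp: cuts_def)
    obtain U V where "compact U" "compact V" "U \<union> V = Z" "U \<inter> V = {}" "?C \<subseteq> U" "D \<inter> Z \<subseteq> V"
    proof (rule compact_separation[OF Z(1), of ?C "D \<inter> Z"])
      show "closedin (top_of_set Z) ?C"
        by (rule closedin_connected_component)
      show "closedin (top_of_set Z) (D \<inter> Z)"
        using D Z by (metis Int_commute closedin_closed_Int compact_imp_closed continuum_joins_def)
      show "C \<inter> (D \<inter> Z) = {}" if C: "compact C" "connected C" "C \<subseteq> Z" "C \<inter> ?C \<noteq> {}" for C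
      proof -
        obtain y where y: "y \<in> C" "connected_component Z z y" using C(4) by blast
        have "C \<subseteq> connected_component_set Z y"
          using y C by (intro connected_component_maximal) auto
        then have "C \<subseteq> ?C"
          using y connected_component_eq by fastforce
        with D show ?thesis by auto
      qed
    qed
    moreover from this have "D \<inter> U = {}" by blast
    ultimately show ?thesis
      using D z unfolding cuts_def by (metis connected_component_refl mem_Collect_eq subsetD)
  qed
  then obtain U V where UV: "\<And>z. z \<in> Z \<Longrightarrow> compact (U z) \<and> compact (V z) \<and> U z \<union> V z = Z \<and>
      U z \<inter> V z = {} \<and> z \<in> U z \<and> \<not> cuts K (U z)"
    by metis
  have finite_not_cut: "\<not> cuts K (\<Union>z\<in>F. U z)" if "finite F" "F \<subseteq> Z" for F
    using that
  proof (induction F)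
    case empty
    show ?case using not_cut[of "{}"] by auto
  next
    case (insert z F)
    define R where "R = (\<Union>z\<in>F. U z)"
    have "compact R"
      unfolding R_def using insert UV by (intro compact_UN) auto
    have "R \<subseteq> Z" unfolding R_def using insert UV by blast
    show ?case
    proof
      assume "cuts K (\<Union>z\<in>insert z F. U z)"
      \<comment> \<open>The part of \<open>R\<close> outside \<open>U z\<close> is
        \<open>R \<inter> V z\<close>, which is compact and disjoint from
        \<open>U z\<close>.\<close>
      moreover have "(\<Union>z\<in>insert z F. U z) = U z \<union> (R \<inter> V z)"
        using \<open>R \<subseteq> Z\<close> UV[of z] insert.prems unfolding R_def[symmetric] by auto (auto simp: R_def)
      ultimately have "cuts K (U z) \<or> cuts K (R \<inter> V z)"
        using insert.prems \<open>R \<subseteq> Z\<close> \<open>compact R\<close> UV[of z] Z(2)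
        by (intro cuts_disjoint_Un[OF K]) (auto intro: compact_Int)
      then show False
        using insert UV[of z] cuts_mono[of K "R \<inter> V z" R] by (auto simp: R_def)
    qed
  qed
  have cov: "Z \<subseteq> (\<Union>z\<in>Z. - V z)"
    using UV by blast
  have opn: "open (- V z)" if "z \<in> Z" for z
    using UV[OF that] compact_imp_closed by blast
  obtain F where F: "F \<subseteq> Z" "finite F" "Z \<subseteq> (\<Union>z\<in>F. - V z)"
    by (rule compactE_image[OF Z(1) opn cov])
  have "Z \<subseteq> (\<Union>z\<in>F. U z)"
  proof
    fix y assume "y \<in> Z"
    then obtain z where "z \<in> F" "y \<notin> V z" using F by auto
    then show "y \<in> (\<Union>z\<in>F. U z)"
      using UV[of z] F(1) \<open>y \<in> Z\<close> by auto
  qed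
  then show False
    using finite_not_cut[OF F(2,1)] cut cuts_mono by blast
qed

section \<open>Folding cylinders in the Hilbert cube\<close>

definition cube :: "(nat \<Rightarrow> real) set" where
  "cube = {y. \<forall>i. y i \<in> {0..1}}"

definition replace_on :: "nat set \<Rightarrow> (nat \<Rightarrow> real) \<Rightarrow> (nat \<Rightarrow> real) \<Rightarrow> nat \<Rightarrow> real" where
  "replace_on F y u = (\<lambda>i. if i \<in> F then u i else y i)"

abbreviation forget :: "nat set \<Rightarrow> (nat \<Rightarrow> real) \<Rightarrow> nat \<Rightarrow> real" where
  "forget F y \<equiv> replace_on F y (\<lambda>_. 0)"

text \<open>The last clause makes \<open>S\<close> a cylinder over its projection along
  \<open>F\<close>; the coordinates in \<open>F\<close> are those not yet tied by an
  equation.\<close>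

definition free_continuum :: "nat set \<Rightarrow> (nat \<Rightarrow> real) set \<Rightarrow> bool" where
  "free_continuum F S \<longleftrightarrow> S \<subseteq> cube \<and> compact S \<and> connected S \<and> S \<noteq> {} \<and>
     (\<forall>y\<in>S. \<forall>u\<in>cube. replace_on F y u \<in> S)"

lemma compact_cube: "compact cube"
proof -
  have "cube = PiE UNIV (\<lambda>_. {0..1})"
    by (auto simp: cube_def PiE_def)
  moreover have "compactin (product_topology (\<lambda>_. euclidean) UNIV) (PiE UNIV (\<lambda>_. {0..1::real}))"
    by (simp add: compactin_PiE compactin_euclidean_iff)
  ultimately show ?thesis
    by (metis compactin_euclidean_iff euclidean_product_topology)
qed

lemma connected_cube: "connected cube"
proof -
  have "cube = PiE UNIV (\<lambda>_. {0..1})"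
    by (auto simp: cube_def PiE_def)
  moreover have "connectedin (product_topology (\<lambda>_. euclidean) UNIV) (PiE UNIV (\<lambda>_. {0..1::real}))"
    by (simp add: connectedin_PiE)
  ultimately show ?thesis
    by (metis connectedin_iff_connected euclidean_product_topology)
qed

lemma continuous_on_replace_on [continuous_intros]:
  assumes "continuous_on S f" "continuous_on S g"
  shows "continuous_on S (\<lambda>x. replace_on F (f x) (g x))"
  unfolding replace_on_def
proof (rule continuous_on_coordinatewise_then_product)
  show "continuous_on S (\<lambda>x. if i \<in> F then g x i else f x i)" for i
    using assms by (cases "i \<in> F") (auto intro: continuous_on_product_then_coordinatewise)
qed

lemma continuous_on_fun_upd [continuous_intros]:
  fixes f :: "'a::topological_space \<Rightarrow> nat \<Rightarrow> real"
  assumes "continuous_on S f" "continuous_on S g"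
  shows "continuous_on S (\<lambda>x. (f x)(m := g x))"
proof (rule continuous_on_coordinatewise_then_product)
  show "continuous_on S (\<lambda>x. ((f x)(m := g x)) i)" for i
    using assms by (cases "i = m") (auto intro: continuous_on_product_then_coordinatewise)
qed

lemma replace_on_in_cube: "y \<in> cube \<Longrightarrow> u \<in> cube \<Longrightarrow> replace_on F y u \<in> cube"
  by (auto simp: cube_def replace_on_def)

lemma fun_upd_in_cube: "y \<in> cube \<Longrightarrow> t \<in> {0..1} \<Longrightarrow> y(m := t) \<in> cube"
  by (auto simp: cube_def)

lemma replace_on_self [simp]: "replace_on F y y = y"
  by (auto simp: replace_on_def fun_eq_iff)

lemma free_continuum_antimono:
  assumes "free_continuum F S" "F' \<subseteq> F"
  shows "free_continuum F' S"
proof -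
  have "replace_on F' y u \<in> S" if "y \<in> S" "u \<in> cube" for y u
  proof -
    have "replace_on F y (replace_on F' y u) \<in> S"
      using assms that replace_on_in_cube unfolding free_continuum_def by blast
    moreover have "replace_on F y (replace_on F' y u) = replace_on F' y u"
      using assms(2) by (fastforce simp: replace_on_def)
    ultimately show ?thesis by simp
  qed
  then show ?thesis using assms(1) by (auto simp: free_continuum_def)
qed

lemma free_continuum_fun_upd:
  assumes "free_continuum F S" "m \<in> F" "y \<in> S" "t \<in> {0..1}"
  shows "y(m := t) \<in> S"
proof -
  have "replace_on F y (y(m := t)) \<in> S"
    using assms fun_upd_in_cube unfolding free_continuum_def by blast
  moreover have "replace_on F y (y(m := t)) = y(m := t)"
    using assms(2) by (fastforce simp: replace_on_def)
  ultimately show ?thesis by simp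
qed

definition saturate :: "nat set \<Rightarrow> (nat \<Rightarrow> real) set \<Rightarrow> (nat \<Rightarrow> real) set" where
  "saturate F C = (\<lambda>(y, u). replace_on F y u) ` (C \<times> cube)"

lemma subset_saturate: "C \<subseteq> cube \<Longrightarrow> C \<subseteq> saturate F C"
  unfolding saturate_def by (force intro: image_eqI[of _ _ "(y, y)" for y])

lemma saturate_subset:
  "(\<And>y u. y \<in> C \<Longrightarrow> u \<in> cube \<Longrightarrow> replace_on F y u \<in> S) \<Longrightarrow> saturate F C \<subseteq> S"
  unfolding saturate_def by auto

lemma free_continuum_saturate:
  assumes "C \<subseteq> cube" "compact C" "connected C" "C \<noteq> {}"
  shows "free_continuum F (saturate F C)"
proof -
  have cont: "continuous_on (C \<times> cube) (\<lambda>(y, u). replace_on F y u)"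
    unfolding case_prod_unfold by (intro continuous_intros)
  have "compact (saturate F C)" "connected (saturate F C)"
    unfolding saturate_def using assms compact_cube connected_cube
    by (auto intro!: compact_continuous_image connected_continuous_image cont compact_Times connected_Times)
  moreover have "saturate F C \<subseteq> cube"
    using assms replace_on_in_cube by (intro saturate_subset) auto
  moreover have "replace_on F y u \<in> saturate F C" if "y \<in> saturate F C" "u \<in> cube" for y u
  proof -
    obtain z v where "z \<in> C" "y = replace_on F z v"
      using \<open>y \<in> saturate F C\<close> by (auto simp: saturate_def)
    then have "replace_on F y u = replace_on F z u" by (auto simp: replace_on_def fun_eq_iff)
    then show ?thesis
      unfolding saturate_def using \<open>z \<in> C\<close> \<open>u \<in> cube\<close> by force
  qed
  moreover have "saturate F C \<noteq> {}"
    using assms subset_saturate by blast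
  ultimately show ?thesis by (simp add: free_continuum_def)
qed

definition cuts_at :: "nat \<Rightarrow> (nat \<Rightarrow> real) set \<Rightarrow> (nat \<Rightarrow> real) set \<Rightarrow> bool" where
  "cuts_at m L Z \<longleftrightarrow> (\<forall>D. D \<subseteq> L \<and> compact D \<and> connected D \<and> (\<exists>y\<in>D. y m = 0) \<and> (\<exists>y\<in>D. y m = 1)
     \<longrightarrow> D \<inter> Z \<noteq> {})"

text \<open>\<open>\<phi>\<close> and \<open>\<psi>\<close> identify \<open>L\<close> with the
  product of its bottom \<open>B\<close> and [0,1]; the connected cutting piece found there is
  spread out over the remaining free coordinates. Cutting is kept in the conclusion so that
  \<open>L'\<close> can later play the role of \<open>Z\<close> for smaller cylinders.\<close>

lemma free_continuum_cut:
  assumes L: "free_continuum F L" and m: "m \<in> F" and Z: "closed Z"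
    and Z_free: "\<And>y u. y \<in> Z \<Longrightarrow> u \<in> cube \<Longrightarrow> replace_on (F - {m}) y u \<in> Z"
    and Z_ends: "\<And>y. y \<in> Z \<Longrightarrow> y m \<noteq> 0 \<and> y m \<noteq> 1"
    and cut: "cuts_at m L Z"
  obtains L' where "free_continuum (F - {m}) L'" "L' \<subseteq> L \<inter> Z" "forget F ` L' = forget F ` L" "cuts_at m L L'"
proof -
  define \<phi> where "\<phi> z = (fst z)(m := snd z)" for z :: "(nat \<Rightarrow> real) \<times> real"
  define \<psi> where "\<psi> y = (y(m := 0), y m)" for y :: "nat \<Rightarrow> real"
  define B where "B = (\<lambda>y. y(m := 0)) ` L"
  have Lc: "L \<subseteq> cube" "compact L" "connected L" "L \<noteq> {}"
    using L by (auto simp: free_continuum_def)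
  have \<phi>_cont: "continuous_on A \<phi>" for A
    unfolding \<phi>_def by (intro continuous_intros)
  have \<psi>_cont: "continuous_on A \<psi>" for A
    unfolding \<psi>_def by (intro continuous_intros continuous_on_product_coordinates[THEN continuous_on_subset]) auto
  have \<phi>\<psi>: "\<phi> (\<psi> y) = y" for y
    by (simp add: \<phi>_def \<psi>_def)
  have B: "compact B" "connected B"
    unfolding B_def using Lc
    by (intro compact_continuous_image connected_continuous_image continuous_on_fun_upd continuous_on_id continuous_on_const; simp)+
  have \<phi>_L: "\<phi> z \<in> L" if "z \<in> B \<times> {0..1}" for z
    using that free_continuum_fun_upd[OF L m] by (auto simp: \<phi>_def B_def)
  have \<psi>_B: "\<psi> y \<in> B \<times> {0..1}" if "y \<in> L" for y
    using that Lc(1) by (auto simp: \<psi>_def B_def cube_def)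
  define Z' where "Z' = (B \<times> {0..1}) \<inter> \<phi> -` Z"
  have "closed (\<phi> -` Z)"
    using Z \<phi>_cont[of UNIV] by (simp add: closed_vimage)
  then have "compact Z'"
    unfolding Z'_def using B by (intro compact_Int_closed compact_Times) auto
  moreover have "Z' \<subseteq> B \<times> {0<..<1}"
  proof
    fix z assume "z \<in> Z'"
    then have "\<phi> z \<in> Z" "z \<in> B \<times> {0..1}" by (auto simp: Z'_def)
    then show "z \<in> B \<times> {0<..<1}"
      using Z_ends[of "\<phi> z"] by (auto simp: \<phi>_def)
  qed
  moreover have "cuts B Z'"
    unfolding cuts_def
  proof (intro allI impI)
    fix D assume D: "continuum_joins B D"
    then obtain x x' where x: "(x, 0) \<in> D" "(x', 1) \<in> D"
      by (auto simp: continuum_joins_def)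
    have "\<phi> ` D \<subseteq> L" "compact (\<phi> ` D)" "connected (\<phi> ` D)"
      using D \<phi>_L by (auto simp: continuum_joins_def intro!: compact_continuous_image connected_continuous_image \<phi>_cont)
    moreover have "\<phi> (x, 0) m = 0" "\<phi> (x', 1) m = 1"
      by (auto simp: \<phi>_def)
    ultimately have "\<phi> ` D \<inter> Z \<noteq> {}"
      using cut x unfolding cuts_at_def by blast
    then show "D \<inter> Z' \<noteq> {}"
      using D by (auto simp: Z'_def continuum_joins_def)
  qed
  ultimately obtain C where C: "C \<subseteq> Z'" "compact C" "connected C" "cuts B C"
    using cuts_connected_subset[OF B] by metis
  \<comment> \<open>A vertical segment is itself a continuum from bottom to top, so \<open>C\<close>
    meets each of them. Hence forgetting \<open>F\<close> loses nothing of the image of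
    \<open>L\<close>.\<close>
  have fibre: "\<exists>t\<in>{0..1}. y(m := t) \<in> \<phi> ` C" if "y \<in> L" for y
  proof -
    have "continuum_joins B ({y(m := 0)} \<times> {0..1})"
      using that by (auto simp: continuum_joins_def B_def intro!: compact_Times connected_Times)
    then obtain t where "t \<in> {0..1}" "(y(m := 0), t) \<in> C"
      using C(4) unfolding cuts_def by blast
    then show ?thesis
      by (intro bexI[of _ t] image_eqI[of _ _ "(y(m := 0), t)"]) (auto simp: \<phi>_def)
  qed
  have \<phi>C: "\<phi> ` C \<subseteq> L" "\<phi> ` C \<subseteq> Z" "compact (\<phi> ` C)" "connected (\<phi> ` C)" "\<phi> ` C \<noteq> {}"
    using C \<phi>_L Lc(4) fibre by (auto simp: Z'_def intro!: compact_continuous_image connected_continuous_image \<phi>_cont)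
  define L' where "L' = saturate (F - {m}) (\<phi> ` C)"
  have "\<phi> ` C \<subseteq> L'"
    unfolding L'_def using \<phi>C Lc by (intro subset_saturate) auto
  show thesis
  proof
    show "free_continuum (F - {m}) L'"
      unfolding L'_def using \<phi>C Lc by (intro free_continuum_saturate) auto
    have "free_continuum (F - {m}) L"
      using L by (rule free_continuum_antimono) auto
    then have "L' \<subseteq> L" "L' \<subseteq> Z"
      unfolding L'_def using \<phi>C Z_free by (auto intro!: saturate_subset simp: free_continuum_def)
    then show "L' \<subseteq> L \<inter> Z" by auto
    show "forget F ` L' = forget F ` L"
    proof
      show "forget F ` L \<subseteq> forget F ` L'"
      proof clarify
        fix y assume "y \<in> L"
        then obtain t where "y(m := t) \<in> L'"
          using fibre \<open>\<phi> ` C \<subseteq> L'\<close> by blast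
        moreover have "forget F y = forget F (y(m := t))"
          using m by (auto simp: replace_on_def fun_eq_iff)
        ultimately show "forget F y \<in> forget F ` L'" by blast
      qed
    qed (use \<open>L' \<subseteq> L\<close> in auto)
    show "cuts_at m L L'"
      unfolding cuts_at_def
    proof (intro allI impI, elim conjE bexE)
      fix D y y' assume D: "D \<subseteq> L" "compact D" "connected D" "y \<in> D" "y m = 0" "y' \<in> D" "y' m = 1"
      have "continuum_joins B (\<psi> ` D)"
        unfolding continuum_joins_def
      proof (intro conjI)
        show "\<psi> ` D \<subseteq> B \<times> {0..1}" using D \<psi>_B by blast
        show "\<exists>x. (x, 0) \<in> \<psi> ` D" "\<exists>x. (x, 1) \<in> \<psi> ` D"
          using D by (auto simp: \<psi>_def image_iff)
      qed (use D in \<open>auto intro!: compact_continuous_image connected_continuous_image \<psi>_cont\<close>)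
      then obtain z where "z \<in> D" "\<psi> z \<in> C"
        using C(4) by (auto simp: cuts_def)
      then have "z \<in> L'"
        using \<phi>\<psi>[of z] \<open>\<phi> ` C \<subseteq> L'\<close> by (metis image_subset_iff)
      with \<open>z \<in> D\<close> show "D \<inter> L' \<noteq> {}" by auto
    qed
  qed
qed

text \<open>The graph rises from -1 at 0 to 2/3 at 1/3, falls to 1/3 at 2/3 and rises to 2 at 1. The
  end values outside [0,1] keep solutions of \<open>g y = zigzag (y m)\<close> off the bottom and
  the top; the turning values lie on either side of 1/2.\<close>

definition zigzag :: "real \<Rightarrow> real" where
  "zigzag t = max (min (5 * t - 1) (1 - t)) (5 * t - 3)"

text \<open>The solution set cuts by the intermediate value theorem. What cuts \<open>S\<close> also
  cuts every subcylinder \<open>L\<close>, so \<open>free_continuum_cut\<close> applies again with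
  \<open>S'\<close> as the cutting set; this lifts cylinders through the fold.\<close>

lemma free_continuum_fold_step:
  assumes S: "free_continuum F S" and m: "m \<in> F"
    and g: "continuous_on UNIV g" "\<And>y. g y \<in> {0..1}" "\<And>y u. g (replace_on F y u) = g y"
  obtains S' where "free_continuum (F - {m}) S'" "S' \<subseteq> S" "\<And>y. y \<in> S' \<Longrightarrow> g y = zigzag (y m)"
    "\<And>L. free_continuum F L \<Longrightarrow> L \<subseteq> S \<Longrightarrow>
       \<exists>L'. free_continuum (F - {m}) L' \<and> L' \<subseteq> L \<inter> S' \<and> forget F ` L' = forget F ` L"
proof -
  define Z where "Z = {y. g y = zigzag (y m)}"
  have cont: "continuous_on A (\<lambda>y. zigzag (y m) - g y)" for A
    unfolding zigzag_def using continuous_on_subset[OF g(1)]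
    by (intro continuous_intros continuous_on_product_coordinates[THEN continuous_on_subset]) auto
  have "closed Z"
    unfolding Z_def zigzag_def by (intro closed_Collect_eq continuous_intros continuous_on_product_coordinates g)
  have Z_free: "replace_on (F - {m}) y u \<in> Z" if "y \<in> Z" "u \<in> cube" for y u
  proof -
    have "g (replace_on (F - {m}) y u) = g (replace_on F (replace_on (F - {m}) y u) y)"
      using g(3) by simp
    also have "replace_on F (replace_on (F - {m}) y u) y = y"
      by (auto simp: replace_on_def fun_eq_iff)
    finally show ?thesis
      using that by (simp add: Z_def replace_on_def)
  qed
  have Z_ends: "y m \<noteq> 0 \<and> y m \<noteq> 1" if "y \<in> Z" for y
    using that g(2)[of y] by (auto simp: Z_def zigzag_def)
  have "cuts_at m S Z"
    unfolding cuts_at_def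
  proof (intro allI impI, elim conjE bexE)
    fix D y y' assume D: "D \<subseteq> S" "compact D" "connected D" "y \<in> D" "y m = 0" "y' \<in> D" "y' m = 1"
    have "zigzag (y m) - g y \<le> 0" "0 \<le> zigzag (y' m) - g y'"
      using g(2)[of y] g(2)[of y'] D by (auto simp: zigzag_def)
    then have "0 \<in> (\<lambda>y. zigzag (y m) - g y) ` D"
      by (rule connectedD_interval[OF connected_continuous_image[OF cont D(3)] imageI[OF D(4)] imageI[OF D(6)]])
    then show "D \<inter> Z \<noteq> {}" by (force simp: Z_def)
  qed
  then obtain S' where S': "free_continuum (F - {m}) S'" "S' \<subseteq> S \<inter> Z" "cuts_at m S S'"
    using Z_free Z_ends free_continuum_cut[OF S m \<open>closed Z\<close>] by metis
  show thesis
  proof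
    show "\<exists>L'. free_continuum (F - {m}) L' \<and> L' \<subseteq> L \<inter> S' \<and> forget F ` L' = forget F ` L"
      if L: "free_continuum F L" "L \<subseteq> S" for L
    proof -
      have "closed S'" using S'(1) by (auto simp: free_continuum_def compact_imp_closed)
      moreover have "replace_on (F - {m}) y u \<in> S'" if "y \<in> S'" "u \<in> cube" for y u
        using S'(1) that by (auto simp: free_continuum_def)
      moreover have "y m \<noteq> 0 \<and> y m \<noteq> 1" if "y \<in> S'" for y
        using S'(2) that Z_ends by auto
      moreover have "cuts_at m L S'"
        using S'(3) L(2) unfolding cuts_at_def by (meson subset_trans)
      ultimately show ?thesis
        using free_continuum_cut[OF L(1) m, of S'] by metis
    qed
  qed (use S' in \<open>auto simp: Z_def\<close>)
qed

section \<open>Lowering the dimension by lines in general position\<close>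

text \<open>The lines \<open>w = 2 i s - i\<^sup>2\<close> are in general position, being tangent to a parabola: any two meet,
  over \<open>s = (i + j) / 2\<close>, and no three do. Here \<open>(s, w) \<in> [0, k] \<times> [-k\<^sup>2, k\<^sup>2]\<close> is rescaled to the unit square.\<close>

definition line_fun :: "nat \<Rightarrow> nat \<Rightarrow> real \<Rightarrow> real \<Rightarrow> real" where
  "line_fun k i s w = (real i)\<^sup>2 - 2 * real i * (real k * s) + (real k)\<^sup>2 * (2 * w - 1)"

definition line_height :: "nat \<Rightarrow> nat \<Rightarrow> real \<Rightarrow> real" where
  "line_height k i s = (1 + (2 * real i * (real k * s) - (real i)\<^sup>2) / (real k)\<^sup>2) / 2"

lemma line_fun_eq_0_iff: "k > 0 \<Longrightarrow> line_fun k i s w = 0 \<longleftrightarrow> w = line_height k i s"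
  by (auto simp: line_fun_def line_height_def field_simps)

text \<open>With \<open>x = k * s\<close>, nonnegativity of the square of \<open>i - x\<close>
  bounds \<open>2 * i * x\<close> minus the square of \<open>i\<close> by the square of
  \<open>x\<close>, hence by that of \<open>k\<close>; the lower bound drops the nonnegative term
  \<open>2 * i * x\<close>.\<close>

lemma line_height_mem:
  assumes "i < k" "s \<in> {0..1}"
  shows "line_height k i s \<in> {0..1}"
proof -
  have i: "(real i)\<^sup>2 \<le> (real k)\<^sup>2" "0 < (real k)\<^sup>2"
    using assms by auto
  have "(real k * s)\<^sup>2 \<le> (real k)\<^sup>2"
    using assms by (simp add: power_mult_distrib mult_left_le power_le_one)
  moreover have "0 \<le> (real i - real k * s)\<^sup>2" by simp
  ultimately have "2 * real i * (real k * s) - (real i)\<^sup>2 \<le> (real k)\<^sup>2"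
    by (simp add: power2_diff algebra_simps)
  moreover have "0 \<le> 2 * real i * (real k * s)"
    using assms by simp
  then have "- ((real k)\<^sup>2) \<le> 2 * real i * (real k * s) - (real i)\<^sup>2"
    using i(1) by linarith
  ultimately have "(2 * real i * (real k * s) - (real i)\<^sup>2) / (real k)\<^sup>2 \<in> {-1..1}"
    using i(2) by (simp add: pos_le_divide_eq pos_divide_le_eq)
  then show ?thesis
    by (simp add: line_height_def)
qed

lemma line_height_meet:
  assumes "k > 0"
  shows "line_height k i ((real i + real j) / (2 * real k)) = line_height k j ((real i + real j) / (2 * real k))"
  using assms by (simp add: line_height_def field_simps power2_eq_square)

text \<open>In \<open>i\<close>, \<open>line_fun k i s w\<close> is quadratic with leading
  coefficient 1, so its second divided difference is 1 whatever \<open>s\<close> and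
  \<open>w\<close> are. The tolerance 1/2 widens the lines to open strips of which still no three
  meet.\<close>

lemma no_three_lines:
  assumes "i < j" "j < l" "\<bar>line_fun k i s w\<bar> < 1/2" "\<bar>line_fun k j s w\<bar> < 1/2" "\<bar>line_fun k l s w\<bar> < 1/2"
  shows False
proof -
  define a b where "a = real j - real i" and "b = real l - real j"
  have ab: "a \<ge> 1" "b \<ge> 1" using assms(1,2) by (simp_all add: a_def b_def)
  have "a * b * (a + b) = b * line_fun k i s w - (a + b) * line_fun k j s w + a * line_fun k l s w"
    by (simp add: a_def b_def line_fun_def power2_eq_square algebra_simps)
  also have "\<dots> < b * (1/2) + (a + b) * (1/2) + a * (1/2)"
  proof -
    have "b * line_fun k i s w < b * (1/2)" "(a + b) * (- line_fun k j s w) < (a + b) * (1/2)"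
      "a * line_fun k l s w < a * (1/2)"
      by (rule mult_strict_left_mono; use ab assms(3-5) in linarith)+
    then show ?thesis by linarith
  qed
  also have "\<dots> = a + b" by (simp add: field_simps)
  finally have "a * b * (a + b) < 1 * (a + b)" by simp
  then have "a * b < 1" using ab by (simp add: mult_less_cancel_right)
  moreover have "1 * 1 \<le> a * b" using ab by (intro mult_mono) auto
  ultimately show False by simp
qed

lemma card_near_lines_le_2: "card {i \<in> A. \<bar>line_fun k i s w\<bar> < 1/2} \<le> 2"
proof (rule ccontr)
  assume "\<not> ?thesis"
  then have "3 \<le> card {i \<in> A. \<bar>line_fun k i s w\<bar> < 1/2}"
    by simp
  then obtain T where T: "T \<subseteq> {i \<in> A. \<bar>line_fun k i s w\<bar> < 1/2}" "card T = 3"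
    by (rule obtain_subset_with_card_n)
  obtain x y z where "T = {x, y, z}" and "x \<noteq> y" "y \<noteq> z" "x \<noteq> z"
    using T(2) unfolding card_3_iff by blast
  with T(1) have xyz: "{x, y, z} \<subseteq> {i \<in> A. \<bar>line_fun k i s w\<bar> < 1/2}" "x \<noteq> y" "y \<noteq> z" "x \<noteq> z"
    by simp_all
  then have "x < y \<and> y < z \<or> x < z \<and> z < y \<or> y < x \<and> x < z \<or> y < z \<and> z < x \<or> z < x \<and> x < y \<or> z < y \<and> y < x"
    by linarith
  moreover have "\<bar>line_fun k x s w\<bar> < 1/2" "\<bar>line_fun k y s w\<bar> < 1/2" "\<bar>line_fun k z s w\<bar> < 1/2"
    using xyz(1) by auto
  ultimately show False
    by (elim disjE conjE) (rule no_three_lines; assumption)+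
qed

definition line_set :: "nat \<Rightarrow> (nat \<Rightarrow> (nat \<Rightarrow> real) set) \<Rightarrow> nat \<Rightarrow> nat \<Rightarrow> (nat \<Rightarrow> real) set" where
  "line_set k A m m' = {y. \<exists>i<k. y \<in> A i \<and> line_fun k i (y m) (y m') = 0}"

text \<open>Setting coordinates \<open>m\<close> and \<open>m'\<close> to 0 is a closed map onto the
  image of \<open>L\<close>, and its fibres are unions of segments any two of which meet. A closed
  map with connected fibres onto a connected set has a connected domain.\<close>

lemma line_set_free_continuum:
  assumes L: "free_continuum F L" and m: "m \<in> F" "m' \<in> F" "m \<noteq> m'" and k: "k > 0"
    and A: "\<And>i. closed (A i)" "\<And>y. \<exists>i<k. y \<in> A i" "\<And>i y u. replace_on F y u \<in> A i \<longleftrightarrow> y \<in> A i"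
  shows "free_continuum (F - {m, m'}) (L \<inter> line_set k A m m')"
    and "forget F ` (L \<inter> line_set k A m m') = forget F ` L"
proof -
  let ?Z = "line_set k A m m'"
  have Lc: "L \<subseteq> cube" "compact L" "connected L" "L \<noteq> {}"
    using L by (auto simp: free_continuum_def)
  define p where "p y = y(m := 0, m' := 0)" for y :: "nat \<Rightarrow> real"
  have upd_L: "y(m := s, m' := w) \<in> L" if "y \<in> L" "s \<in> {0..1}" "w \<in> {0..1}" for y s w
    using that free_continuum_fun_upd[OF L] m by blast
  have upd_A: "y(m := s, m' := w) \<in> A i \<longleftrightarrow> y \<in> A i" for y s w i
  proof -
    have "replace_on F y (y(m := s, m' := w)) = y(m := s, m' := w)"
      using m by (auto simp: replace_on_def)
    then show ?thesis using A(3) by metis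
  qed
  have "closed ?Z"
  proof -
    have "?Z = (\<Union>i<k. A i \<inter> {y. line_fun k i (y m) (y m') = 0})"
      by (auto simp: line_set_def)
    moreover have "closed {y. line_fun k i (y m) (y m') = 0}" for i
      unfolding line_fun_def by (intro closed_Collect_eq continuous_intros continuous_on_product_coordinates)
    ultimately show ?thesis using A(1) by (simp add: closed_Int closed_UN)
  qed
  then have comp: "compact (L \<inter> ?Z)"
    using Lc by (simp add: compact_Int_closed)
  define seg where "seg b i = (\<lambda>s. b(m := s, m' := line_height k i s)) ` {0..1}" for b i
  have seg_conn: "connected (seg b i)" for b i
    unfolding seg_def line_height_def by (intro connected_continuous_image continuous_intros) (use k in auto)
  have seg_sub: "seg y i \<subseteq> L \<inter> ?Z" if "y \<in> L" "i < k" "y \<in> A i" for y i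
  proof
    fix z assume "z \<in> seg y i"
    then obtain s where s: "s \<in> {0..1}" "z = y(m := s, m' := line_height k i s)"
      by (auto simp: seg_def)
    then have "z \<in> L" using upd_L line_height_mem that by blast
    moreover have "z \<in> A i" using s upd_A that by blast
    moreover have "line_fun k i (z m) (z m') = 0"
      using s m k by (simp add: line_fun_eq_0_iff)
    ultimately show "z \<in> L \<inter> ?Z" using that by (auto simp: line_set_def)
  qed
  have seg_p: "p z = p y" if "z \<in> seg y i" for y z i
    using that m by (auto simp: seg_def p_def)
  have lift: "\<exists>z\<in>L \<inter> ?Z. p z = p y" if "y \<in> L" for y
  proof -
    obtain i where i: "i < k" "y \<in> A i" using A(2) by blast
    have "y(m := 0, m' := line_height k i 0) \<in> seg y i" by (auto simp: seg_def)
    then show ?thesis using seg_sub[OF that i] seg_p by blast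
  qed
  have "connected ((L \<inter> ?Z) \<inter> p -` (p ` L))"
  proof (rule connected_closed_monotone_preimage[where T = "p ` L"])
    show p_cont: "continuous_on (L \<inter> ?Z) p"
      unfolding p_def by (intro continuous_on_fun_upd continuous_on_id continuous_on_const)
    show "p ` (L \<inter> ?Z) = p ` L"
    proof
      show "p ` L \<subseteq> p ` (L \<inter> ?Z)"
      proof (rule image_subsetI)
        fix y assume "y \<in> L"
        then obtain z where "z \<in> L \<inter> ?Z" "p z = p y" using lift by blast
        then show "p y \<in> p ` (L \<inter> ?Z)" by (metis imageI)
      qed
    qed auto
    show "closedin (top_of_set (p ` L)) (p ` C)" if "closedin (top_of_set (L \<inter> ?Z)) C" for C
    proof -
      have "compact C" "C \<subseteq> L \<inter> ?Z" using that comp closedin_compact closedin_imp_subset by blast+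
      then have "compact (p ` C)"
        using p_cont compact_continuous_image continuous_on_subset by blast
      with \<open>C \<subseteq> L \<inter> ?Z\<close> show ?thesis by (intro closed_subset compact_imp_closed) auto
    qed
    show "connected (p ` L)"
      unfolding p_def using Lc
      by (intro connected_continuous_image continuous_on_fun_upd continuous_on_id continuous_on_const)
    show "connected ((L \<inter> ?Z) \<inter> p -` {b})" if b: "b \<in> p ` L" for b
    proof -
      obtain y where y: "y \<in> L" "b = p y" using b by auto
      obtain i0 where i0: "i0 < k" "y \<in> A i0" using A(2) by blast
      define I where "I = {i. i < k \<and> y \<in> A i}"
      \<comment> \<open>\<open>seg y i0\<close> is put into every member: all members then share its
        points, and each is connected because its two lines meet.\<close>
      have "(L \<inter> ?Z) \<inter> p -` {b} = (\<Union>i\<in>I. seg y i0 \<union> seg y i)"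
      proof
        show "(\<Union>i\<in>I. seg y i0 \<union> seg y i) \<subseteq> (L \<inter> ?Z) \<inter> p -` {b}"
          using seg_sub seg_p y i0 by (auto simp: I_def)
        show "(L \<inter> ?Z) \<inter> p -` {b} \<subseteq> (\<Union>i\<in>I. seg y i0 \<union> seg y i)"
        proof
          fix z assume z: "z \<in> (L \<inter> ?Z) \<inter> p -` {b}"
          then obtain i where i: "i < k" "z \<in> A i" "line_fun k i (z m) (z m') = 0"
            by (auto simp: line_set_def)
          have zy: "z = y(m := z m, m' := z m')"
          proof
            fix n
            have "p z n = p y n" using z y by auto
            then show "z n = (y(m := z m, m' := z m')) n" by (auto simp: p_def split: if_splits)
          qed
          then have "y \<in> A i" using upd_A i by metis
          moreover have "z m' = line_height k i (z m)" using i k by (simp add: line_fun_eq_0_iff)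
          moreover have "z m \<in> {0..1}" using z Lc by (auto simp: cube_def)
          ultimately have "z \<in> seg y i" "i \<in> I"
            using zy i by (auto simp: seg_def I_def)
          then show "z \<in> (\<Union>i\<in>I. seg y i0 \<union> seg y i)" by auto
        qed
      qed
      moreover have "connected (\<Union>i\<in>I. seg y i0 \<union> seg y i)"
      proof (rule connected_Union)
        show "\<Inter> ((\<lambda>i. seg y i0 \<union> seg y i) ` I) \<noteq> {}"
          by (auto simp: seg_def)
        show "connected S" if S: "S \<in> (\<lambda>i. seg y i0 \<union> seg y i) ` I" for S
        proof -
          obtain i where i: "i \<in> I" "S = seg y i0 \<union> seg y i" using S by auto
          let ?s = "(real i0 + real i) / (2 * real k)"
          have "?s \<in> {0..1}"
            using i i0 k by (auto simp: I_def field_simps)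
          then have "y(m := ?s, m' := line_height k i0 ?s) \<in> seg y i0 \<inter> seg y i"
            unfolding seg_def by (metis (no_types, lifting) IntI imageI line_height_meet[OF k, of i0 i])
          then show ?thesis
            unfolding i(2) by (intro connected_Un seg_conn) blast
        qed
      qed
      ultimately show ?thesis by simp
    qed
  qed auto
  moreover have "(L \<inter> ?Z) \<inter> p -` (p ` L) = L \<inter> ?Z" by auto
  ultimately have conn: "connected (L \<inter> ?Z)" by simp
  have "replace_on (F - {m, m'}) y u \<in> L \<inter> ?Z" if y: "y \<in> L \<inter> ?Z" and u: "u \<in> cube" for y u
  proof -
    have "free_continuum (F - {m, m'}) L"
      using L by (rule free_continuum_antimono) auto
    then have "replace_on (F - {m, m'}) y u \<in> L"
      using y u by (auto simp: free_continuum_def)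
    moreover have "replace_on (F - {m, m'}) y u \<in> A i \<longleftrightarrow> y \<in> A i" for i
    proof -
      have "replace_on F y (replace_on (F - {m, m'}) y u) = replace_on (F - {m, m'}) y u"
        by (auto simp: replace_on_def)
      then show ?thesis using A(3) by metis
    qed
    ultimately show ?thesis
      using y by (auto simp: line_set_def replace_on_def)
  qed
  then show "free_continuum (F - {m, m'}) (L \<inter> ?Z)"
    using comp conn Lc lift unfolding free_continuum_def by blast
  show "forget F ` (L \<inter> ?Z) = forget F ` L"
  proof
    show "forget F ` L \<subseteq> forget F ` (L \<inter> ?Z)"
    proof clarify
      fix y assume "y \<in> L"
      then obtain z where z: "z \<in> L \<inter> ?Z" "p z = p y" using lift by blast
      have "forget F z = forget F (p z)" "forget F y = forget F (p y)"
        using m by (auto simp: p_def replace_on_def)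
      then show "forget F y \<in> forget F ` (L \<inter> ?Z)" using z by (metis imageI)
    qed
  qed auto
qed

section \<open>The inverse sequence\<close>

text \<open>A weighted l1-distance to a rational point in finitely many coordinates. The parameters
  form a countable type and the unit balls a basis, so all folds and covers can be
  enumerated.\<close>

definition box_gauge :: "rat list \<times> nat \<Rightarrow> (nat \<Rightarrow> real) \<Rightarrow> real" where
  "box_gauge a y = real (snd a) * (\<Sum>i<length (fst a). \<bar>y i - of_rat (fst a ! i)\<bar>)"

lemma continuous_on_box_gauge: "continuous_on UNIV (box_gauge a)"
  unfolding box_gauge_def
  by (intro continuous_on_mult continuous_on_const continuous_on_sum continuous_on_rabs continuous_on_diff
      continuous_on_product_coordinates)

lemma box_gauge_replace_on:
  assumes "\<And>i. i \<in> F \<Longrightarrow> length (fst a) \<le> i"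
  shows "box_gauge a (replace_on F y u) = box_gauge a y"
proof -
  have "i \<notin> F" if "i < length (fst a)" for i using assms that by (meson not_le)
  then show ?thesis unfolding box_gauge_def replace_on_def by auto
qed

lemma box_gauge_basis:
  assumes "open U" "y \<in> U"
  obtains a where "box_gauge a y < 1/4" "\<And>z. box_gauge a z < 1 \<Longrightarrow> z \<in> U"
proof -
  have "openin (product_topology (\<lambda>_. euclidean) UNIV) U"
    using assms(1) unfolding open_fun_def .
  from product_topology_open_contains_basis[OF this assms(2)]
  have "\<exists>X. y \<in> PiE UNIV X \<and> (\<forall>i. open (X i)) \<and> finite {i. X i \<noteq> UNIV} \<and> PiE UNIV X \<subseteq> U"
    by simp
  then obtain X where X: "y \<in> PiE UNIV X" "\<And>i. open (X i)" "finite {i. X i \<noteq> UNIV}" "PiE UNIV X \<subseteq> U"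
    by (elim exE conjE) simp
  obtain N where N: "\<And>i. X i \<noteq> UNIV \<Longrightarrow> i < N"
    using X(3) unfolding finite_nat_set_iff_bounded by auto
  have "\<exists>e>0. ball (y i) e \<subseteq> X i" for i
    using X(1,2) open_contains_ball by (metis PiE_mem UNIV_I)
  then obtain e where e: "\<And>i. e i > 0" "\<And>i. ball (y i) (e i) \<subseteq> X i" by metis
  define d where "d = Min (insert 1 (e ` {..<N}))"
  have d: "d > 0" "\<And>i. i < N \<Longrightarrow> d \<le> e i"
    using e(1) by (auto simp: d_def)
  \<comment> \<open>Both \<open>y\<close> and \<open>z\<close> will be within \<open>1 / q\<close>
    of the rational centre in each coordinate, hence within \<open>d\<close> of each other. The
    smaller bound \<open>r\<close> makes the weighted sum over \<open>N\<close> coordinates stay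
    below 1/4.\<close>
  obtain q :: nat where q: "real q > 2 / d" using reals_Archimedean2 by blast
  then have "q > 0" using d by (metis divide_pos_pos less_trans of_nat_0_less_iff zero_less_numeral)
  have qd: "2 / real q < d" using q d \<open>q > 0\<close> by (simp add: field_simps)
  define r where "r = 1 / (4 * real q * (real N + 1))"
  have "r > 0" using \<open>q > 0\<close> by (simp add: r_def)
  have "\<exists>p. \<bar>y i - of_rat p\<bar> < r" for i
  proof -
    obtain p where "y i - r < of_rat p" "of_rat p < y i + r"
      using of_rat_dense[of "y i - r" "y i + r"] \<open>r > 0\<close> by auto
    then show ?thesis by (intro exI[of _ p]) auto
  qed
  then obtain p where p: "\<And>i. \<bar>y i - of_rat (p i)\<bar> < r" by metis
  define a where "a = (map p [0..<N], q)"
  have gauge_a: "box_gauge a z = real q * (\<Sum>i<N. \<bar>z i - of_rat (p i)\<bar>)" for z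
    by (simp add: box_gauge_def a_def)
  show thesis
  proof
    have "(\<Sum>i<N. \<bar>y i - of_rat (p i)\<bar>) \<le> (\<Sum>i<N. r)"
      using p by (intro sum_mono) (auto intro: less_imp_le)
    then have "box_gauge a y \<le> real q * (real N * r)"
      unfolding gauge_a by (intro mult_left_mono) auto
    also have "\<dots> = real N / (4 * (real N + 1))"
      using \<open>q > 0\<close> by (simp add: r_def)
    also have "\<dots> < 1/4"
      by (simp add: divide_less_eq)
    finally show "box_gauge a y < 1/4" .
    show "z \<in> U" if "box_gauge a z < 1" for z
    proof -
      have "z i \<in> X i" for i
      proof (cases "i < N")
        case True
        have "\<bar>z i - of_rat (p i)\<bar> \<le> (\<Sum>i<N. \<bar>z i - of_rat (p i)\<bar>)"
          using True by (intro member_le_sum) auto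
        also have "\<dots> < 1 / real q"
          using that \<open>q > 0\<close> by (simp add: gauge_a field_simps)
        finally have "\<bar>z i - of_rat (p i)\<bar> < 1 / real q" .
        moreover have "r \<le> 1 / real q"
          unfolding r_def using \<open>q > 0\<close> by (intro frac_le) (simp_all add: algebra_simps)
        ultimately have "\<bar>y i - z i\<bar> < 2 / real q"
          using p[of i] by (simp add: field_simps)
        then have "z i \<in> ball (y i) (e i)"
          using qd d(2)[OF True] by (simp add: dist_real_def)
        then show ?thesis using e by blast
      next
        case False
        then show ?thesis using N by blast
      qed
      then show ?thesis using X(4) by auto
    qed
  qed
qed

text \<open>For gauges \<open>a\<close>, \<open>b\<close> with disjoint unit balls, \<open>sep_fun a b\<close> is \<open>0\<close> deep inside the ball of \<open>a\<close>, \<open>1\<close> deep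
  inside that of \<open>b\<close>, and \<open>1/2\<close> off both.\<close>

definition sep_fun :: "rat list \<times> nat \<Rightarrow> rat list \<times> nat \<Rightarrow> (nat \<Rightarrow> real) \<Rightarrow> real" where
  "sep_fun a b y = max 0 (min 1 (1/2 + max 0 (1 - box_gauge b y) - max 0 (1 - box_gauge a y)))"

text \<open>The set with index \<open>0\<close> makes this a cover of the whole space for every \<open>ps\<close>; it misses \<open>Y\<close> as soon as the
  half-balls already cover \<open>Y\<close>. No instance has to wait until \<open>S\<^sub>n\<close> is close enough to \<open>Y\<close>.\<close>

definition cover_set :: "(rat list \<times> nat) list \<Rightarrow> nat \<Rightarrow> (nat \<Rightarrow> real) set" where
  "cover_set ps i = (if i = 0 then {y. \<forall>a\<in>set ps. 1/2 \<le> box_gauge a y} else {y. box_gauge (ps ! (i - 1)) y \<le> 1/2})"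

lemma closed_cover_set: "closed (cover_set ps i)"
proof -
  have "{y. \<forall>a\<in>set ps. 1/2 \<le> box_gauge a y} = (\<Inter>a\<in>set ps. {y. 1/2 \<le> box_gauge a y})" by auto
  moreover have "closed {y. 1/2 \<le> box_gauge a y}" "closed {y. box_gauge a y \<le> 1/2}" for a
    by (intro closed_Collect_le continuous_on_box_gauge continuous_on_const)+
  ultimately show ?thesis
    by (simp add: cover_set_def closed_INT del: divide_le_eq_numeral1 le_divide_eq_numeral1)
qed

lemma cover_set_covers: "\<exists>i<Suc (length ps). y \<in> cover_set ps i"
proof (cases "\<forall>a\<in>set ps. 1/2 \<le> box_gauge a y")
  case True
  then show ?thesis by (intro exI[of _ 0]) (auto simp: cover_set_def)
next
  case False
  then obtain j where "j < length ps" "box_gauge (ps ! j) y \<le> 1/2"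
    by (metis in_set_conv_nth linear)
  then show ?thesis by (intro exI[of _ "Suc j"]) (auto simp: cover_set_def)
qed

text \<open>One datum carries both a fold and a cover, so a single enumeration serves both. The
  property is inherited by subsets, hence by the limit from any stage.\<close>

definition resolves :: "(rat list \<times> nat) \<times> (rat list \<times> nat) \<times> (rat list \<times> nat) list \<Rightarrow> (nat \<Rightarrow> real) set \<Rightarrow> bool" where
  "resolves = (\<lambda>(a, b, ps) S. (\<exists>m. \<forall>y\<in>S. sep_fun a b y = zigzag (y m)) \<and>
     (\<exists>m m'. S \<subseteq> line_set (Suc (length ps)) (cover_set ps) m m'))"

lemma resolves_antimono:
  assumes "resolves d S" "S' \<subseteq> S"
  shows "resolves d S'"
proof -
  obtain a b ps where d: "d = (a, b, ps)" by (cases d)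
  show ?thesis
    using assms unfolding d resolves_def prod.case by (meson order_trans subsetD)
qed

text \<open>The even coordinates carry \<open>X\<close> and are never tied; the odd ones below
  \<open>N\<close> may already be in use.\<close>

definition free_coords :: "nat \<Rightarrow> nat set" where
  "free_coords N = {i. odd i \<and> N \<le> i}"

text \<open>The form of weak confluence that composes along the sequence: \<open>L'\<close> is again
  a cylinder, in the coordinates still free after the step.\<close>

definition lifts_to :: "nat set \<Rightarrow> (nat \<Rightarrow> real) set \<Rightarrow> nat set \<Rightarrow> (nat \<Rightarrow> real) set \<Rightarrow> bool" where
  "lifts_to F S F' S' \<longleftrightarrow> (\<forall>L. free_continuum F L \<and> L \<subseteq> S \<longrightarrow>
     (\<exists>L'. free_continuum F' L' \<and> L' \<subseteq> L \<inter> S' \<and> forget F ` L' = forget F ` L))"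

lemma forget_image_mono:
  assumes "forget F ` A = forget F ` B" "F \<subseteq> G"
  shows "forget G ` A = forget G ` B"
proof -
  have "forget G y = forget G (forget F y)" for y
    using assms(2) by (fastforce simp: replace_on_def)
  then have "forget G ` C = forget G ` (forget F ` C)" for C
    by (simp add: image_image)
  then show ?thesis using assms(1) by metis
qed

lemma resolving_step:
  assumes S: "free_continuum (free_coords N) S"
  obtains N' S' where "N \<le> N'" "free_continuum (free_coords N') S'" "S' \<subseteq> S" "resolves d S'"
    "lifts_to (free_coords N) S (free_coords N') S'"
proof -
  obtain a b ps where d: "d = (a, b, ps)" by (cases d)
  \<comment> \<open>No gauge in \<open>d\<close> depends on coordinates from \<open>M\<close> on, so
    \<open>sep_fun a b\<close> and the cover are constant along \<open>?F\<close>. The odd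
    coordinates \<open>2 * M + 1\<close> (fold), \<open>2 * M + 3\<close> and
    \<open>2 * M + 5\<close> (lines) can then be tied, and \<open>2 * M + 6\<close> lies past
    them.\<close>
  define M where "M = N + length (fst a) + length (fst b) + (\<Sum>c\<leftarrow>ps. length (fst c))"
  have M: "N \<le> M" "length (fst a) \<le> M" "length (fst b) \<le> M" "\<And>c. c \<in> set ps \<Longrightarrow> length (fst c) \<le> M"
  proof -
    have "length (fst c) \<le> (\<Sum>c\<leftarrow>ps. length (fst c))" if "c \<in> set ps" for c
      using that by (intro member_le_sum_list) auto
    then show "length (fst c) \<le> M" if "c \<in> set ps" for c
      using that by (simp add: M_def trans_le_add2)
  qed (auto simp: M_def)
  let ?F = "free_coords M" and ?m = "2 * M + 1" and ?m1 = "2 * M + 3" and ?m2 = "2 * M + 5"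
  let ?Z = "line_set (Suc (length ps)) (cover_set ps) ?m1 ?m2"
  have FN: "?F \<subseteq> free_coords N" using M by (auto simp: free_coords_def)
  have g: "box_gauge c (replace_on G y u) = box_gauge c y" if "length (fst c) \<le> M" "G \<subseteq> ?F" for c G y u
    using that by (intro box_gauge_replace_on) (auto simp: free_coords_def)
  have sep_cont: "continuous_on UNIV (sep_fun a b)"
    unfolding sep_fun_def by (intro continuous_intros continuous_on_box_gauge)
  have sep_range: "sep_fun a b y \<in> {0..1}" for y by (auto simp: sep_fun_def)
  have sep_free: "sep_fun a b (replace_on ?F y u) = sep_fun a b y" for y u
    using g M by (simp add: sep_fun_def)
  have S_F: "free_continuum ?F S" using S FN by (rule free_continuum_antimono)
  have mF: "?m \<in> ?F" by (auto simp: free_coords_def)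
  obtain S1 where S1: "free_continuum (?F - {?m}) S1" "S1 \<subseteq> S" "\<And>y. y \<in> S1 \<Longrightarrow> sep_fun a b y = zigzag (y ?m)"
    "\<And>L. free_continuum ?F L \<Longrightarrow> L \<subseteq> S \<Longrightarrow>
       \<exists>L'. free_continuum (?F - {?m}) L' \<and> L' \<subseteq> L \<inter> S1 \<and> forget ?F ` L' = forget ?F ` L"
    using free_continuum_fold_step[OF S_F mF sep_cont sep_range sep_free] by blast
  have cov_free: "replace_on (?F - {?m}) y u \<in> cover_set ps i \<longleftrightarrow> y \<in> cover_set ps i" if "i < Suc (length ps)" for y u i
    using g[OF M(4), of _ "?F - {?m}"] that by (auto simp: cover_set_def)
  define A where "A i = (if i < Suc (length ps) then cover_set ps i else {})" for i
  have Z_eq: "line_set (Suc (length ps)) A ?m1 ?m2 = ?Z"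
    unfolding line_set_def A_def by auto
  have A: "closed (A i)" "\<exists>i<Suc (length ps). y \<in> A i" "replace_on (?F - {?m}) y u \<in> A i \<longleftrightarrow> y \<in> A i" for i y u
    using closed_cover_set cover_set_covers[of ps y] cov_free unfolding A_def by (simp, meson, simp)
  have m12: "?m1 \<in> ?F - {?m}" "?m2 \<in> ?F - {?m}" "?m1 \<noteq> ?m2" by (auto simp: free_coords_def)
  have Z: "free_continuum (?F - {?m} - {?m1, ?m2}) (L \<inter> ?Z)" "forget (?F - {?m}) ` (L \<inter> ?Z) = forget (?F - {?m}) ` L"
    if "free_continuum (?F - {?m}) L" for L
    using line_set_free_continuum[OF that m12 zero_less_Suc A] unfolding Z_eq by blast+
  have sub: "free_coords (2 * M + 6) \<subseteq> ?F - {?m} - {?m1, ?m2}"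
    by (auto simp: free_coords_def)
  show thesis
  proof
    show "N \<le> 2 * M + 6" using M by simp
    show "free_continuum (free_coords (2 * M + 6)) (S1 \<inter> ?Z)"
      using Z(1)[OF S1(1)] sub by (rule free_continuum_antimono)
    show "S1 \<inter> ?Z \<subseteq> S" using S1 by auto
    show "resolves d (S1 \<inter> ?Z)"
      unfolding d resolves_def using S1(3) by auto
    show "lifts_to (free_coords N) S (free_coords (2 * M + 6)) (S1 \<inter> ?Z)"
      unfolding lifts_to_def
    proof (intro allI impI, elim conjE)
      fix L assume L: "free_continuum (free_coords N) L" "L \<subseteq> S"
      obtain L1 where L1: "free_continuum (?F - {?m}) L1" "L1 \<subseteq> L \<inter> S1" "forget ?F ` L1 = forget ?F ` L"
        using S1(4)[OF free_continuum_antimono[OF L(1) FN] L(2)] by blast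
      have "forget (free_coords N) ` (L1 \<inter> ?Z) = forget (free_coords N) ` L1"
        by (rule forget_image_mono[OF Z(2)[OF L1(1)]]) (use FN in blast)
      also have "\<dots> = forget (free_coords N) ` L"
        using L1(3) FN by (rule forget_image_mono)
      finally have "forget (free_coords N) ` (L1 \<inter> ?Z) = forget (free_coords N) ` L" .
      moreover have "free_continuum (free_coords (2 * M + 6)) (L1 \<inter> ?Z)"
        using Z(1)[OF L1(1)] sub by (rule free_continuum_antimono)
      moreover have "L1 \<inter> ?Z \<subseteq> L \<inter> (S1 \<inter> ?Z)"
        using L1(2) by blast
      ultimately show "\<exists>L'. free_continuum (free_coords (2 * M + 6)) L' \<and> L' \<subseteq> L \<inter> (S1 \<inter> ?Z) \<and>
          forget (free_coords N) ` L' = forget (free_coords N) ` L"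
        by (intro exI[of _ "L1 \<inter> ?Z"] conjI)
    qed
  qed
qed

lemma resolving_sequence:
  fixes d :: "nat \<Rightarrow> (rat list \<times> nat) \<times> (rat list \<times> nat) \<times> (rat list \<times> nat) list"
  assumes "free_continuum (free_coords N0) S0"
  obtains N S where "N 0 = N0" "S 0 = S0" "\<And>n. free_continuum (free_coords (N n)) (S n)"
    "\<And>n. N n \<le> N (Suc n)" "\<And>n. S (Suc n) \<subseteq> S n" "\<And>n. resolves (d n) (S (Suc n))"
    "\<And>n. lifts_to (free_coords (N n)) (S n) (free_coords (N (Suc n))) (S (Suc n))"
proof -
  let ?P = "\<lambda>n (x :: nat \<times> (nat \<Rightarrow> real) set). free_continuum (free_coords (fst x)) (snd x) \<and> (n = 0 \<longrightarrow> x = (N0, S0))"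
  let ?Q = "\<lambda>n (x :: nat \<times> (nat \<Rightarrow> real) set) y. fst x \<le> fst y \<and> snd y \<subseteq> snd x \<and> resolves (d n) (snd y) \<and>
    lifts_to (free_coords (fst x)) (snd x) (free_coords (fst y)) (snd y)"
  have "\<exists>f. \<forall>n. ?P n (f n) \<and> ?Q n (f n) (f (Suc n))"
  proof (rule dependent_nat_choice)
    show "\<exists>x. ?P 0 x" using assms by auto
    show "\<exists>y. ?P (Suc n) y \<and> ?Q n x y" if x: "?P n x" for x n
    proof -
      obtain N' S' where "fst x \<le> N'" "free_continuum (free_coords N') S'" "S' \<subseteq> snd x" "resolves (d n) S'"
        "lifts_to (free_coords (fst x)) (snd x) (free_coords N') S'"
        using resolving_step[of "fst x" "snd x" "d n"] x by blast
      then show ?thesis by (intro exI[of _ "(N', S')"]) auto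
    qed
  qed
  then obtain f where f: "\<And>n. ?P n (f n)" "\<And>n. ?Q n (f n) (f (Suc n))" by blast
  show thesis
    by (rule that[of "fst \<circ> f" "snd \<circ> f"]) (use f in auto)
qed

section \<open>Decreasing sequences of compact sets and continua\<close>

lemma compact_INT_t2:
  fixes S :: "nat \<Rightarrow> 'a::t2_space set"
  assumes "\<And>n. compact (S n)"
  shows "compact (\<Inter>n. S n)"
proof -
  have "compact (S 0 \<inter> (\<Inter>n. S n))"
    using assms by (intro compact_Int_closed closed_INT) (auto intro: compact_imp_closed)
  moreover have "S 0 \<inter> (\<Inter>n. S n) = (\<Inter>n. S n)" by auto
  ultimately show ?thesis by simp
qed

lemma nested_compact_nonempty:
  fixes S :: "nat \<Rightarrow> 'a::metric_space set"
  assumes "\<And>n. compact (S n)" "\<And>n. S n \<noteq> {}" "\<And>n. S (Suc n) \<subseteq> S n"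
  shows "(\<Inter>n. S n) \<noteq> {}"
proof (rule compact_space_imp_nest)
  show "compact_space (top_of_set (S 0))"
    using assms(1) by (simp add: compact_space_subtopology)
  show dec: "decseq S" using assms(3) by (rule decseq_SucI)
  show "closedin (top_of_set (S 0)) (S n)" for n
    using assms(1) decseqD[OF dec] by (intro closed_subset compact_imp_closed) auto
qed (use assms in auto)

lemma nested_compact_connected:
  fixes S :: "nat \<Rightarrow> 'a::metric_space set"
  assumes "\<And>n. compact (S n)" "\<And>n. connected (S n)" "\<And>n. S (Suc n) \<subseteq> S n"
  shows "connected (\<Inter>n. S n)"
proof (rule ccontr)
  assume "\<not> connected (\<Inter>n. S n)"
  moreover have cl: "closed (\<Inter>n. S n)"
    using assms(1) by (auto intro: compact_imp_closed)
  ultimately obtain A B where AB: "closed A" "closed B" "A \<noteq> {}" "B \<noteq> {}" "A \<union> B = (\<Inter>n. S n)" "A \<inter> B = {}"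
    by (auto simp: connected_closed_set)
  obtain U V where UV: "open U" "open V" "A \<subseteq> U" "B \<subseteq> V" "U \<inter> V = {}"
    using t4_space[OF AB(1,2,6)] by blast
  have "(\<Inter>n. S n - (U \<union> V)) = {}"
    using AB(5) UV(3,4) by auto
  moreover have "compact (S n - (U \<union> V))" "S (Suc n) - (U \<union> V) \<subseteq> S n - (U \<union> V)" for n
    using assms(1,3)[of n] UV(1,2) by (auto intro: compact_diff)
  ultimately obtain n where n: "S n - (U \<union> V) = {}"
    using nested_compact_nonempty[of "\<lambda>n. S n - (U \<union> V)"] by blast
  have "A \<subseteq> S n" "B \<subseteq> S n" using AB(5) by blast+
  then have "U \<inter> S n \<noteq> {}" "V \<inter> S n \<noteq> {}"
    using UV(3,4) AB(3,4) by blast+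
  moreover have "U \<inter> V \<inter> S n = {}" "S n \<subseteq> U \<union> V"
    using UV(5) n by blast+
  ultimately show False
    using connectedD[OF assms(2) UV(1,2)] by blast
qed

text \<open>Lifting step by step gives a decreasing sequence of cylinders with one common
  projection. Their intersection is compact and connected, and compactness of the nested fibres
  \<open>R n\<close> keeps the projection onto.\<close>

lemma resolving_limit_lift:
  assumes S: "\<And>n. free_continuum (free_coords (N n)) (S n)" "\<And>n. N n \<le> N (Suc n)" "\<And>n. S (Suc n) \<subseteq> S n"
    and lift: "\<And>n. lifts_to (free_coords (N n)) (S n) (free_coords (N (Suc n))) (S (Suc n))"
    and L: "free_continuum (free_coords (N 0)) L" "L \<subseteq> S 0"
  obtains K where "compact K" "connected K" "K \<subseteq> (\<Inter>n. S n)"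
    "forget (free_coords (N 0)) ` K = forget (free_coords (N 0)) ` L"
proof -
  let ?P = "\<lambda>n T. free_continuum (free_coords (N n)) T \<and> T \<subseteq> S n \<and> (n = 0 \<longrightarrow> T = L)"
  let ?Q = "\<lambda>n T T'. T' \<subseteq> T \<and> forget (free_coords (N n)) ` T' = forget (free_coords (N n)) ` T"
  have "\<exists>T. \<forall>n. ?P n (T n) \<and> ?Q n (T n) (T (Suc n))"
  proof (rule dependent_nat_choice)
    show "\<exists>T. ?P 0 T" using L by auto
    show "\<exists>T'. ?P (Suc n) T' \<and> ?Q n T T'" if "?P n T" for T n
      using lift[of n] that unfolding lifts_to_def by (metis Int_subset_iff nat.distinct(1))
  qed
  then obtain T where "\<forall>n. ?P n (T n) \<and> ?Q n (T n) (T (Suc n))" ..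
  then have T: "\<And>n. ?P n (T n)" "\<And>n. ?Q n (T n) (T (Suc n))" by simp_all
  have comp: "compact (T n)" and conn: "connected (T n)" for n
    using T(1) by (auto simp: free_continuum_def)
  have mono: "N 0 \<le> N n" for n
    using S(2) by (induction n) (auto intro: order_trans)
  have img: "forget (free_coords (N 0)) ` T n = forget (free_coords (N 0)) ` L" for n
  proof (induction n)
    case 0
    then show ?case using T(1) by auto
  next
    case (Suc n)
    have "free_coords (N n) \<subseteq> free_coords (N 0)"
      using mono[of n] by (auto simp: free_coords_def)
    then show ?case
      using Suc T(2)[of n] forget_image_mono by metis
  qed
  show thesis
  proof
    show "compact (\<Inter>n. T n)"
      using comp by (rule compact_INT_t2)
    show "connected (\<Inter>n. T n)"
      using comp conn T(2) by (intro nested_compact_connected) auto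
    show "(\<Inter>n. T n) \<subseteq> (\<Inter>n. S n)" using T(1) by blast
    show "forget (free_coords (N 0)) ` (\<Inter>n. T n) = forget (free_coords (N 0)) ` L"
    proof
      show "forget (free_coords (N 0)) ` (\<Inter>n. T n) \<subseteq> forget (free_coords (N 0)) ` L"
        using img by blast
      show "forget (free_coords (N 0)) ` L \<subseteq> forget (free_coords (N 0)) ` (\<Inter>n. T n)"
      proof (rule image_subsetI)
        fix y assume "y \<in> L"
        define R where "R n = T n \<inter> {z. forget (free_coords (N 0)) z = forget (free_coords (N 0)) y}" for n
        have "closed {z. forget (free_coords (N 0)) z = forget (free_coords (N 0)) y}"
          by (intro closed_Collect_eq continuous_intros)
        then have "compact (R n)" for n
          unfolding R_def using comp by (simp add: compact_Int_closed)
        moreover have "R n \<noteq> {}" for n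
        proof -
          have "forget (free_coords (N 0)) y \<in> forget (free_coords (N 0)) ` T n"
            using img \<open>y \<in> L\<close> by blast
          then show ?thesis by (force simp: R_def)
        qed
        moreover have "R (Suc n) \<subseteq> R n" for n
          using T(2)[of n] by (auto simp: R_def)
        ultimately obtain z where z: "z \<in> (\<Inter>n. R n)"
          using nested_compact_nonempty[of R] by blast
        then have "z \<in> (\<Inter>n. T n)" "forget (free_coords (N 0)) z = forget (free_coords (N 0)) y"
          by (auto simp: R_def)
        then show "forget (free_coords (N 0)) y \<in> forget (free_coords (N 0)) ` (\<Inter>n. T n)"
          by (metis imageI)
      qed
    qed
  qed
qed

section \<open>Properties of the limit\<close>

lemma continuum_top_of_set:
  fixes S :: "'a::metric_space set"
  shows "continuum (top_of_set S) \<longleftrightarrow> compact S \<and> connected S \<and> S \<noteq> {}"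
proof -
  have "connected_space (top_of_set S) \<longleftrightarrow> connected S"
    using connectedin_iff_connected[of S] by (simp add: connectedin_def)
  moreover have "compact_space (top_of_set S) \<longleftrightarrow> compact S"
    by (simp add: compact_space_def compactin_subtopology)
  moreover have "Hausdorff_space (top_of_set S)"
    by (simp add: metrizable_imp_Hausdorff_space metrizable_space_subtopology metrizable_space_euclidean)
  ultimately show ?thesis by (simp add: continuum_def)
qed

lemma subcontinuum_top_of_set:
  fixes S :: "'a::metric_space set"
  shows "subcontinuum (top_of_set S) K \<longleftrightarrow> K \<subseteq> S \<and> compact K \<and> connected K \<and> K \<noteq> {}"
  by (auto simp: subcontinuum_def subtopology_subtopology Int_absorb1 continuum_top_of_set)

lemma zigzag_eq_0: "zigzag t = 0 \<Longrightarrow> t < 1/3"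
  by (auto simp: zigzag_def max_def min_def split: if_splits)

lemma zigzag_eq_1: "zigzag t = 1 \<Longrightarrow> t > 2/3"
  by (auto simp: zigzag_def max_def min_def split: if_splits)

text \<open>If a continuum were \<open>A \<union> B\<close> with proper subcontinua \<open>A \<ni> a\<close> and \<open>B \<ni> b\<close>, then folding at a function
  separating \<open>a\<close> from \<open>b\<close> would confine \<open>A\<close> to the first and \<open>B\<close> to the third leg of the zigzag.\<close>

lemma folding_imp_hereditarily_indecomposable:
  assumes Y: "compact Y" "connected Y" "Y \<noteq> {}"
    and fold: "\<And>a b. \<exists>m. \<forall>y\<in>Y. sep_fun a b y = zigzag (y m)"
  shows "hereditarily_indecomposable (top_of_set Y)"
proof -
  have "False" if K: "K \<subseteq> Y" "connected K" and A: "compact A" "connected A" "A \<noteq> K"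
    and B: "compact B" "connected B" "B \<noteq> K" and AB: "A \<union> B = K" for K A B
  proof -
    obtain a b where a: "a \<in> A" "a \<notin> B" and b: "b \<in> B" "b \<notin> A"
      using A(3) B(3) AB by blast
    then have "a \<noteq> b" by auto
    then obtain U V where UV: "open U" "open V" "a \<in> U" "b \<in> V" "U \<inter> V = {}"
      using hausdorff by metis
    have op: "open (U - B)" "open (V - A)"
      using UV A(1) B(1) by (auto intro: open_Diff compact_imp_closed)
    \<comment> \<open>The unit ball of \<open>p\<close> misses \<open>B\<close> and that of
      \<open>q\<close> misses \<open>A\<close>. Hence \<open>sep_fun p q\<close> is at most 1/2 on
      \<open>A\<close> and at least 1/2 on \<open>B\<close>, with value 0 at \<open>a\<close> and 1
      at \<open>b\<close>.\<close>
    obtain p where p: "box_gauge p a < 1/4" "\<And>z. box_gauge p z < 1 \<Longrightarrow> z \<in> U - B"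
      using box_gauge_basis[OF op(1), of a] a UV by blast
    obtain q where q: "box_gauge q b < 1/4" "\<And>z. box_gauge q z < 1 \<Longrightarrow> z \<in> V - A"
      using box_gauge_basis[OF op(2), of b] b UV by blast
    obtain m where m: "\<And>y. y \<in> Y \<Longrightarrow> sep_fun p q y = zigzag (y m)"
      using fold by blast
    have pA: "box_gauge q y \<ge> 1" if "y \<in> A" for y using q(2)[of y] that by fastforce
    have qB: "box_gauge p y \<ge> 1" if "y \<in> B" for y using p(2)[of y] that by fastforce
    have conn: "connected ((\<lambda>y. y m) ` C)" if "connected C" for C :: "(nat \<Rightarrow> real) set"
      using that continuous_on_subset[OF continuous_on_product_coordinates[of m]]
      by (intro connected_continuous_image) auto
    have "sep_fun p q a = 0" "sep_fun p q b = 1"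
      using pA[OF a(1)] qB[OF b(1)] p(1) q(1) by (auto simp: sep_fun_def)
    then have am: "a m < 1/3" and bm: "b m > 2/3"
      using m[of a] m[of b] a b AB K zigzag_eq_0 zigzag_eq_1 by auto
    \<comment> \<open>To leave the first leg, \<open>A\<close> would have to pass
      \<open>y m = 1/3\<close>, where the zigzag has the value 2/3, above the bound 1/2. The
      argument for \<open>B\<close> is symmetric.\<close>
    have "y m < 1/3" if y: "y \<in> A" for y
    proof (rule ccontr)
      assume "\<not> y m < 1/3"
      then have "1/3 \<in> (\<lambda>y. y m) ` A"
        using am by (intro connectedD_interval[OF conn[OF A(2)] imageI[OF a(1)] imageI[OF y]]) auto
      then obtain z where z: "z \<in> A" "z m = 1/3" by force
      then have "sep_fun p q z = 2/3" using m[of z] AB K by (auto simp: zigzag_def)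
      moreover have "sep_fun p q z \<le> 1/2"
        using pA[OF z(1)] unfolding sep_fun_def by (simp add: max_def)
      ultimately show False by simp
    qed
    moreover have "y m > 2/3" if y: "y \<in> B" for y
    proof (rule ccontr)
      assume "\<not> y m > 2/3"
      then have "2/3 \<in> (\<lambda>y. y m) ` B"
        using bm by (intro connectedD_interval[OF conn[OF B(2)] imageI[OF y] imageI[OF b(1)]]) auto
      then obtain z where z: "z \<in> B" "z m = 2/3" by force
      then have "sep_fun p q z = 1/3" using m[of z] AB K by (auto simp: zigzag_def)
      moreover have "sep_fun p q z \<ge> 1/2"
        using qB[OF z(1)] unfolding sep_fun_def by (simp add: max_def min_def)
      ultimately show False by simp
    qed
    ultimately have "A \<inter> B = {}" by fastforce
    then show False
      using connected_closedD[OF K(2), of A B] A(1) B(1) AB a(1) b(1) compact_imp_closed by blast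
  qed
  then have "\<not> decomposable (top_of_set K)" if "K \<subseteq> Y" for K
    using that by (auto simp: decomposable_def continuum_top_of_set subcontinuum_top_of_set)
  then have "indecomposable (top_of_set K)" if "subcontinuum (top_of_set Y) K" for K
    using that by (simp add: indecomposable_def continuum_top_of_set subcontinuum_top_of_set)
  moreover have "subtopology (top_of_set Y) K = top_of_set K" if "subcontinuum (top_of_set Y) K" for K
    using that by (simp add: subcontinuum_top_of_set subtopology_subtopology Int_absorb1)
  ultimately show ?thesis
    using Y by (simp add: hereditarily_indecomposable_def continuum_top_of_set)
qed

text \<open>Once the gauge balls of radius 1/4 cover \<open>Y\<close>, each point of
  \<open>Y\<close> lies on a line of index at least 1 and in the corresponding ball of radius 1/2.
  So unit balls cut down to strips around the lines cover \<open>Y\<close>, and no point lies in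
  three strips.\<close>

lemma lines_imp_covering_dim_le_1:
  assumes Y: "compact Y" and lines: "\<And>ps. \<exists>m m'. Y \<subseteq> line_set (Suc (length ps)) (cover_set ps) m m'"
  shows "covering_dim_le (top_of_set Y) 1"
  unfolding covering_dim_le_def
proof (intro allI impI, elim conjE)
  fix \<U> assume \<U>: "finite \<U>" "\<forall>U\<in>\<U>. openin (top_of_set Y) U" "\<Union>\<U> = topspace (top_of_set Y)"
  have "\<exists>a. box_gauge a y < 1/4 \<and> (\<exists>U\<in>\<U>. \<forall>z\<in>Y. box_gauge a z < 1 \<longrightarrow> z \<in> U)" if y: "y \<in> Y" for y
  proof -
    obtain U where U: "U \<in> \<U>" "y \<in> U" using \<U>(3) y by auto
    then obtain T where T: "open T" "U = Y \<inter> T" using \<U>(2) by (auto simp: openin_open)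
    obtain a where "box_gauge a y < 1/4" "\<And>z. box_gauge a z < 1 \<Longrightarrow> z \<in> T"
      using box_gauge_basis[OF T(1), of y] U T by blast
    then show ?thesis using U T by blast
  qed
  then obtain a where a: "\<And>y. y \<in> Y \<Longrightarrow> box_gauge (a y) y < 1/4"
      "\<And>y. y \<in> Y \<Longrightarrow> \<exists>U\<in>\<U>. \<forall>z\<in>Y. box_gauge (a y) z < 1 \<longrightarrow> z \<in> U"
    by metis
  have op: "open {z. box_gauge (a y) z < 1/4}" for y
    by (intro open_Collect_less continuous_on_box_gauge continuous_on_const)
  have cov: "Y \<subseteq> (\<Union>y\<in>Y. {z. box_gauge (a y) z < 1/4})"
    using a(1) by blast
  obtain F where F: "F \<subseteq> Y" "finite F" "Y \<subseteq> (\<Union>y\<in>F. {z. box_gauge (a y) z < 1/4})"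
    by (rule compactE_image[OF Y op cov])
  obtain ps where ps: "set ps = a ` F" using F(2) by (metis finite_imageI finite_list)
  let ?n = "length ps"
  obtain m m' where m: "Y \<subseteq> line_set (Suc ?n) (cover_set ps) m m'" using lines by blast
  \<comment> \<open>Index 0 belongs to the remainder set of \<open>cover_set\<close>, so ball
    \<open>j\<close> goes with line \<open>Suc j\<close>.\<close>
  define L where "L j y = line_fun (Suc ?n) (Suc j) (y m) (y m')" for j and y :: "nat \<Rightarrow> real"
  define V where "V j = {y \<in> Y. box_gauge (ps ! j) y < 1 \<and> \<bar>L j y\<bar> < 1/2}" for j
  have V_open: "openin (top_of_set Y) (V j)" for j
  proof -
    have "V j = Y \<inter> ({y. box_gauge (ps ! j) y < 1} \<inter> {y. \<bar>L j y\<bar> < 1/2})"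
      by (auto simp: V_def)
    moreover have "open {y. box_gauge (ps ! j) y < 1}"
      by (intro open_Collect_less continuous_on_box_gauge continuous_on_const)
    moreover have "open {y. \<bar>L j y\<bar> < 1/2}"
      unfolding L_def line_fun_def
      by (intro open_Collect_less continuous_intros continuous_on_product_coordinates)
    ultimately show ?thesis by (metis open_Int openin_open_Int)
  qed
  have V_cover: "\<exists>j<?n. y \<in> V j" if y: "y \<in> Y" for y
  proof -
    obtain i where i: "i < Suc ?n" "y \<in> cover_set ps i" "line_fun (Suc ?n) i (y m) (y m') = 0"
      using m y by (auto simp: line_set_def)
    obtain c where c: "c \<in> set ps" "box_gauge c y < 1/4"
      using F(3) y ps by blast
    have "i \<noteq> 0"
    proof
      assume "i = 0"
      then have "1/2 \<le> box_gauge c y" using i(2) c(1) by (simp add: cover_set_def)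
      with c(2) show False by simp
    qed
    then obtain j where "i = Suc j" by (cases i) auto
    then show ?thesis
      using i y by (intro exI[of _ j]) (auto simp: V_def L_def cover_set_def)
  qed
  have V_sub: "\<exists>U\<in>\<U>. V j \<subseteq> U" if "j < ?n" for j
  proof -
    have "ps ! j \<in> a ` F" using that ps nth_mem by blast
    then obtain y where "y \<in> Y" "ps ! j = a y" using F(1) by auto
    then show ?thesis using a(2)[of y] by (auto simp: V_def)
  qed
  have V_card: "card {W \<in> V ` {..<?n}. y \<in> W} \<le> 2" for y
  proof -
    let ?I = "{i \<in> {..?n}. \<bar>line_fun (Suc ?n) i (y m) (y m')\<bar> < 1/2}"
    \<comment> \<open>\<open>i - 1\<close> undoes the shift; at \<open>i = 0\<close> it yields
      \<open>V 0\<close> once more, which is harmless for an inclusion.\<close>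
    have "{W \<in> V ` {..<?n}. y \<in> W} \<subseteq> (\<lambda>i. V (i - 1)) ` ?I"
    proof
      fix W assume "W \<in> {W \<in> V ` {..<?n}. y \<in> W}"
      then obtain j where "j < ?n" "W = V j" "y \<in> V j" by auto
      then show "W \<in> (\<lambda>i. V (i - 1)) ` ?I"
        by (intro image_eqI[of _ _ "Suc j"]) (auto simp: V_def L_def)
    qed
    then have "card {W \<in> V ` {..<?n}. y \<in> W} \<le> card ?I"
      by (rule surj_card_le[rotated]) simp
    also have "\<dots> \<le> 2" by (rule card_near_lines_le_2)
    finally show ?thesis .
  qed
  show "\<exists>\<V>. finite \<V> \<and> (\<forall>V\<in>\<V>. openin (top_of_set Y) V) \<and> \<Union>\<V> = topspace (top_of_set Y) \<and>
      (\<forall>V\<in>\<V>. \<exists>U\<in>\<U>. V \<subseteq> U) \<and> (\<forall>x\<in>topspace (top_of_set Y). card {V \<in> \<V>. x \<in> V} \<le> 1 + 1)"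
  proof (intro exI[of _ "V ` {..<?n}"] conjI)
    show "\<Union> (V ` {..<?n}) = topspace (top_of_set Y)"
      using V_cover by (auto simp: V_def)
    show "\<forall>x\<in>topspace (top_of_set Y). card {W \<in> V ` {..<?n}. x \<in> W} \<le> 1 + 1"
      using V_card by (simp add: numeral_2_eq_2[symmetric])
  qed (use V_open V_sub in auto)
qed

text \<open>A refinement of order one of the cover by the complements of \<open>a\<close> and
  \<open>b\<close> is disjoint. Its member containing \<open>a\<close> is then clopen, hence all of
  \<open>Y\<close>, yet lies in one of the complements.\<close>

lemma connected_not_covering_dim_le_0:
  fixes Y :: "'a::metric_space set"
  assumes Y: "connected Y" and ab: "a \<in> Y" "b \<in> Y" "a \<noteq> b"
  shows "\<not> covering_dim_le (top_of_set Y) 0"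
proof
  assume dim: "covering_dim_le (top_of_set Y) 0"
  have "openin (top_of_set Y) (Y - {c})" for c
    by (metis openin_delete openin_subtopology_self)
  moreover have "\<Union> {Y - {a}, Y - {b}} = topspace (top_of_set Y)" using ab by auto
  ultimately obtain \<V> where \<V>: "finite \<V>" "\<forall>V\<in>\<V>. openin (top_of_set Y) V" "\<Union>\<V> = Y"
    "\<forall>V\<in>\<V>. \<exists>U\<in>{Y - {a}, Y - {b}}. V \<subseteq> U" "\<forall>x\<in>Y. card {V \<in> \<V>. x \<in> V} \<le> 1"
    using dim[unfolded covering_dim_le_def, rule_format, of "{Y - {a}, Y - {b}}"] by auto
  obtain V where V: "V \<in> \<V>" "a \<in> V" using \<V>(3) ab by auto
  let ?W = "\<Union>(\<V> - {V})"
  have disj: "V \<inter> ?W = {}"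
  proof (rule ccontr)
    assume "V \<inter> ?W \<noteq> {}"
    then obtain x V' where x: "x \<in> V" "x \<in> V'" "V' \<in> \<V>" "V' \<noteq> V" by auto
    then have "card {V, V'} \<le> card {V \<in> \<V>. x \<in> V}"
      using \<V>(1) V by (intro card_mono) auto
    moreover have "x \<in> Y" using x \<V>(3) by auto
    ultimately have "card {V, V'} \<le> 1" using \<V>(5) order_trans by blast
    then show False using x(4) by simp
  qed
  have "openin (top_of_set Y) V" "openin (top_of_set Y) ?W"
    using \<V>(2) V by (auto intro: openin_Union)
  moreover have "V \<union> ?W = Y" using \<V>(3) V by auto
  ultimately have "?W = {}"
    using Y disj V(2) unfolding connected_openin by (metis empty_iff order_refl)
  then have "V = Y" using \<open>V \<union> ?W = Y\<close> by blast
  then show False using \<V>(4) V ab by auto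
qed

section \<open>Countable bases and the embedding in the Hilbert cube\<close>

lemma second_countable_top_of_set:
  "second_countable (top_of_set (S :: 'a::second_countable_topology set))"
proof -
  obtain \<B> :: "'a set set" where "countable \<B>" "\<And>C. C \<in> \<B> \<Longrightarrow> open C" "\<And>S. open S \<Longrightarrow> \<exists>U. U \<subseteq> \<B> \<and> S = \<Union>U"
    using univ_second_countable by blast
  note \<B> = this
  have "\<exists>V\<in>\<B>. x \<in> V \<and> V \<subseteq> U" if "open U" "x \<in> U" for U x
    using \<B>(3)[OF that(1)] that(2) by blast
  then have "second_countable (euclidean :: 'a topology)"
    unfolding second_countable_def using \<B>(1,2) by (intro exI[of _ \<B>]) simp
  then show ?thesis by (rule second_countable_subtopology)
qed

text \<open>The coordinates are distances, truncated at 1, to the points of a countable dense set,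
  the union of finite nets.\<close>

lemma compact_metrizable_embeds_in_cube:
  assumes "metrizable_space X" "compact_space X" "topspace X \<noteq> {}"
  obtains f :: "'a \<Rightarrow> nat \<Rightarrow> real"
  where "continuous_map X euclidean f" "inj_on f (topspace X)" "f ` topspace X \<subseteq> cube"
proof -
  obtain M d where "Metric_space M d" and X: "X = Metric_space.mtopology M d"
    using assms(1) by (auto simp: metrizable_space_def)
  then interpret Metric_space M d by simp
  have "compactin mtopology M"
    using assms(2) by (simp add: X compact_space_def)
  then have "mtotally_bounded M"
    by (rule compactin_imp_mtotally_bounded)
  then have "\<exists>K. finite K \<and> K \<subseteq> M \<and> M \<subseteq> (\<Union>x\<in>K. mball x (inverse (real (Suc n))))" for n
    by (simp add: mtotally_bounded_def)
  then obtain K where K: "\<And>n. finite (K n)" "\<And>n. K n \<subseteq> M" "\<And>n. M \<subseteq> (\<Union>x\<in>K n. mball x (inverse (real (Suc n))))"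
    by metis
  define C where "C = (\<Union>n. K n)"
  define f where "f x n = min 1 (d x (from_nat_into C n))" for x n
  have dense: "\<exists>n. from_nat_into C n \<in> M \<and> d x (from_nat_into C n) < e" if x: "x \<in> M" and e: "e > 0" for x e
  proof -
    obtain n where n: "inverse (real (Suc n)) < e"
      using reals_Archimedean[OF e] by blast
    obtain c where c: "c \<in> K n" "x \<in> mball c (inverse (real (Suc n)))"
      using K(3)[of n] x by blast
    have "countable C"
      unfolding C_def using K(1) by (simp add: countable_finite)
    then obtain k where "from_nat_into C k = c"
      using c(1) from_nat_into_surj[of C c] by (auto simp: C_def)
    then show ?thesis
      using c n K(2)[of n] by (intro exI[of _ k]) (auto simp: commute)
  qed
  have "C \<subseteq> M" using K(2) by (auto simp: C_def)
  show thesis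
  proof
    show "continuous_map X euclidean f"
      unfolding euclidean_product_topology[symmetric] continuous_map_componentwise_UNIV
    proof
      fix n
      show "continuous_map X euclideanreal (\<lambda>x. f x n)"
      proof -
        have "M \<noteq> {}" using assms(3) by (simp add: X)
        then have "C \<noteq> {}" using K(3)[of 0] by (auto simp: C_def)
        then have c: "from_nat_into C n \<in> M"
          using \<open>C \<subseteq> M\<close> from_nat_into[of C n] by auto
        have "continuous_map mtopology euclideanreal (\<lambda>x. mdist (metric (M, d)) x (from_nat_into C n))"
          by (rule continuous_map_mdist) (use c in \<open>simp_all add: mtopology_of\<close>)
        then show ?thesis
          unfolding f_def X by (intro continuous_map_real_min) (auto simp: mdist_metric)
      qed
    qed
    show "inj_on f (topspace X)"
    proof (rule inj_onI, rule ccontr)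
      fix x y assume xy: "x \<in> topspace X" "y \<in> topspace X" "f x = f y" "x \<noteq> y"
      then have M: "x \<in> M" "y \<in> M" by (auto simp: X)
      \<comment> \<open>As \<open>e\<close> is at most 1/2, truncation is inactive at the chosen
        point, which is thus equally close to \<open>x\<close> and \<open>y\<close>; as
        \<open>e\<close> is at most half of \<open>d x y\<close>, this contradicts the triangle
        inequality.\<close>
      define e where "e = min 1 (d x y) / 2"
      have "e > 0" using xy(4) M by (simp add: e_def)
      then obtain n where n: "from_nat_into C n \<in> M" "d x (from_nat_into C n) < e"
        using dense M by blast
      have "d x y \<le> d x (from_nat_into C n) + d y (from_nat_into C n)"
        using triangle[OF M(1) n(1) M(2)] by (simp add: commute)
      moreover have "min 1 (d x (from_nat_into C n)) = min 1 (d y (from_nat_into C n))"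
        using fun_cong[OF xy(3), of n] by (simp add: f_def)
      ultimately show False
        using n(2) by (simp add: e_def min_def split: if_splits)
    qed
    show "f ` topspace X \<subseteq> cube"
      by (auto simp: f_def cube_def)
  qed
qed

section \<open>The product of the embedded space with a cube in the odd coordinates\<close>

definition interleave :: "(nat \<Rightarrow> real) \<Rightarrow> (nat \<Rightarrow> real) \<Rightarrow> nat \<Rightarrow> real" where
  "interleave x u = (\<lambda>i. if even i then x (i div 2) else u i)"

definition evens :: "(nat \<Rightarrow> real) \<Rightarrow> nat \<Rightarrow> real" where
  "evens y = (\<lambda>i. y (2 * i))"

definition times_cube :: "(nat \<Rightarrow> real) set \<Rightarrow> (nat \<Rightarrow> real) set" where
  "times_cube K = (\<lambda>(x, u). interleave x u) ` (K \<times> cube)"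

lemma evens_interleave [simp]: "evens (interleave x u) = x"
  by (simp add: evens_def interleave_def)

lemma continuous_on_evens: "continuous_on S evens"
  unfolding evens_def
  by (intro continuous_on_coordinatewise_then_product)
     (rule continuous_on_subset[OF continuous_on_product_coordinates subset_UNIV])

lemma times_cube_mono: "K \<subseteq> K' \<Longrightarrow> times_cube K \<subseteq> times_cube K'"
  by (auto simp: times_cube_def)

lemma free_continuum_times_cube:
  assumes K: "K \<subseteq> cube" "compact K" "connected K" "K \<noteq> {}"
  shows "free_continuum (free_coords N) (times_cube K)"
proof -
  have "continuous_on (K \<times> cube) (\<lambda>(x, u). interleave x u)"
    unfolding case_prod_unfold interleave_def
  proof (rule continuous_on_coordinatewise_then_product)
    show "continuous_on (K \<times> cube) (\<lambda>z. if even i then fst z (i div 2) else snd z i)" for i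
      by (cases "even i")
         (auto intro!: continuous_on_product_then_coordinatewise continuous_on_fst continuous_on_snd continuous_on_id)
  qed
  then have "compact (times_cube K)" "connected (times_cube K)"
    unfolding times_cube_def using K compact_cube connected_cube
    by (auto intro!: compact_continuous_image connected_continuous_image compact_Times connected_Times)
  moreover have "times_cube K \<subseteq> cube"
    using K(1) by (auto simp: times_cube_def interleave_def cube_def)
  moreover have "times_cube K \<noteq> {}"
    using K(4) by (auto simp: times_cube_def cube_def intro!: exI[of _ "\<lambda>_. 0"])
  moreover have "replace_on (free_coords N) y u \<in> times_cube K" if "y \<in> times_cube K" and u: "u \<in> cube" for y u
  proof -
    obtain x v where x: "x \<in> K" "v \<in> cube" "y = interleave x v"
      using \<open>y \<in> times_cube K\<close> by (auto simp: times_cube_def)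
    then have "replace_on (free_coords N) y u = interleave x (replace_on (free_coords N) v u)"
      by (auto simp: replace_on_def interleave_def free_coords_def)
    then show ?thesis
      using x u replace_on_in_cube unfolding times_cube_def by force
  qed
  ultimately show ?thesis by (simp add: free_continuum_def)
qed

text \<open>Free coordinates are odd. Equal projections in the lifting lemmas therefore give equal
  images in the embedded copy of \<open>X\<close>.\<close>

lemma evens_forget: "evens (forget (free_coords N) y) = evens y"
  by (auto simp: evens_def replace_on_def free_coords_def)

lemma evens_image_cong:
  assumes "forget (free_coords N) ` A = forget (free_coords N) ` B"
  shows "evens ` A = evens ` B"
proof -
  have "evens ` C = evens ` (forget (free_coords N) ` C)" for C
    by (simp add: image_image evens_forget)
  then show ?thesis using assms by metis
qed

lemma evens_times_cube: "evens ` times_cube K = K"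
proof -
  have "(\<lambda>_. 0) \<in> cube" by (simp add: cube_def)
  then show ?thesis by (force simp: times_cube_def image_image case_prod_unfold)
qed

theorem theorem2p1:
  fixes X :: "'a topology"
  assumes "metrizable_space X" and "continuum X"
  shows "\<exists>(Y :: (nat \<Rightarrow> real) topology) (\<pi> :: (nat \<Rightarrow> real) \<Rightarrow> 'a).
           continuum Y \<and> one_dimensional Y \<and> hereditarily_indecomposable Y \<and>
           second_countable Y \<and> metrizable_space Y \<and>
           continuous_map Y X \<pi> \<and> \<pi> ` topspace Y = topspace X \<and> weakly_confluent Y X \<pi>"
proof -
  have X: "compact_space X" "connected_space X" "Hausdorff_space X" "topspace X \<noteq> {}"
    using assms(2) by (auto simp: continuum_def)
  obtain f :: "'a \<Rightarrow> nat \<Rightarrow> real" where f: "continuous_map X euclidean f" "inj_on f (topspace X)" "f ` topspace X \<subseteq> cube"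
    using compact_metrizable_embeds_in_cube[OF assms(1) X(1,4)] by blast
  have f_image: "f ` C \<subseteq> cube" "compact (f ` C)" "connected (f ` C)" "f ` C \<noteq> {}" if C: "subcontinuum X C" for C
  proof -
    have CX: "C \<subseteq> topspace X" "compact_space (subtopology X C)" "connected_space (subtopology X C)" "C \<noteq> {}"
      using C by (auto simp: subcontinuum_def continuum_def)
    then have "compactin X C" "connectedin X C"
      by (auto simp: compactin_subspace connectedin_def)
    then show "compact (f ` C)" "connected (f ` C)"
      using image_compactin[OF _ f(1)] connectedin_continuous_map_image[OF f(1)] by auto
    show "f ` C \<subseteq> cube" "f ` C \<noteq> {}" using CX f(3) by auto
  qed
  define g where "g = inv_into (topspace X) f"
  have g_f: "g (f x) = x" if "x \<in> topspace X" for x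
    using f(2) that by (simp add: g_def)
  have g_cont: "continuous_map (top_of_set (f ` topspace X)) X g"
  proof -
    have "homeomorphic_map X (top_of_set (f ` topspace X)) f"
      using f X by (intro continuous_imp_homeomorphic_map)
        (auto simp: continuous_map_in_subtopology metrizable_imp_Hausdorff_space metrizable_space_subtopology metrizable_space_euclidean)
    then obtain h where h: "homeomorphic_maps X (top_of_set (f ` topspace X)) f h"
      using homeomorphic_map_maps by blast
    then have "continuous_map (top_of_set (f ` topspace X)) X h"
      by (simp add: homeomorphic_maps_def)
    moreover have "g y = h y" if "y \<in> topspace (top_of_set (f ` topspace X))" for y
      using that h g_f by (auto simp: homeomorphic_maps_def)
    ultimately show ?thesis by (metis continuous_map_eq)
  qed
  have X_sub: "subcontinuum X (topspace X)"
    using assms(2) by (simp add: subcontinuum_def)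
  let ?K = "f ` topspace X"
  \<comment> \<open>Coordinate 1 is odd but below 3, so no step ties it and every lift keeps its
    range [0,1]. Thus \<open>Y\<close> has two points even if \<open>X\<close> has only one.\<close>
  obtain N S where N0: "N 0 = 3" and S0: "S 0 = times_cube ?K"
    and S: "\<And>n. free_continuum (free_coords (N n)) (S n)" "\<And>n. N n \<le> N (Suc n)" "\<And>n. S (Suc n) \<subseteq> S n"
    and res: "\<And>n. resolves (from_nat n) (S (Suc n))"
    and lift: "\<And>n. lifts_to (free_coords (N n)) (S n) (free_coords (N (Suc n))) (S (Suc n))"
    using resolving_sequence[OF free_continuum_times_cube[OF f_image[OF X_sub]], of 3 from_nat] by metis
  define Y where "Y = (\<Inter>n. S n)"
  have Sc: "compact (S n)" "connected (S n)" "S n \<noteq> {}" for n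
    using S(1)[of n] by (auto simp: free_continuum_def)
  have Y: "compact Y" "connected Y" "Y \<noteq> {}"
    unfolding Y_def
    using compact_INT_t2[of S] nested_compact_connected[of S] nested_compact_nonempty[of S] Sc S(3)
    by simp_all
  have res_Y: "resolves d Y" for d
  proof -
    \<comment> \<open>The data form a countable type, so each \<open>d\<close> is treated at stage
      \<open>to_nat d\<close>.\<close>
    have "resolves d (S (Suc (to_nat d)))" using res[of "to_nat d"] by simp
    then show ?thesis by (rule resolves_antimono) (auto simp: Y_def)
  qed
  have lift_Y: "\<exists>K'. subcontinuum (top_of_set Y) K' \<and> evens ` K' = f ` C \<and> (\<lambda>y. y 1) ` K' = {0..1}"
    if C: "subcontinuum X C" for C
  proof -
    have "times_cube (f ` C) \<subseteq> S 0"
      unfolding S0 using C by (intro times_cube_mono image_mono) (simp add: subcontinuum_def)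
    then obtain K' where K': "compact K'" "connected K'" "K' \<subseteq> Y"
      "forget (free_coords 3) ` K' = forget (free_coords 3) ` times_cube (f ` C)"
      using resolving_limit_lift[of N S "times_cube (f ` C)", OF S lift, unfolded N0] free_continuum_times_cube[OF f_image[OF C]]
      unfolding Y_def by metis
    have "evens ` K' = f ` C"
      using evens_image_cong[OF K'(4)] by (simp add: evens_times_cube)
    moreover have "K' \<noteq> {}"
      using calculation f_image(4)[OF C] by auto
    moreover have "(\<lambda>y. y 1) ` K' = {0..1}"
    proof -
      have "(\<lambda>y. y 1) ` T = (\<lambda>y. y 1) ` (forget (free_coords 3) ` T)" for T :: "(nat \<Rightarrow> real) set"
        by (simp add: image_image replace_on_def free_coords_def)
      then have "(\<lambda>y. y 1) ` K' = (\<lambda>y. y 1) ` times_cube (f ` C)"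
        using K'(4) by metis
      also have "\<dots> = {0..1}"
      proof
        show "(\<lambda>y. y 1) ` times_cube (f ` C) \<subseteq> {0..1}"
          by (auto simp: times_cube_def interleave_def cube_def)
        show "{0..1} \<subseteq> (\<lambda>y. y 1) ` times_cube (f ` C)"
        proof
          fix t :: real assume t: "t \<in> {0..1}"
          obtain x where "x \<in> f ` C" using f_image(4)[OF C] by blast
          then have "interleave x (\<lambda>_. t) \<in> times_cube (f ` C)"
            using t by (auto simp: times_cube_def cube_def)
          moreover have "interleave x (\<lambda>_. t) 1 = t" by (simp add: interleave_def)
          ultimately show "t \<in> (\<lambda>y. y 1) ` times_cube (f ` C)" by (metis imageI)
        qed
      qed
      finally show ?thesis .
    qed
    moreover have "subcontinuum (top_of_set Y) K'"
      using K'(1-3) \<open>K' \<noteq> {}\<close> by (simp add: subcontinuum_top_of_set)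
    ultimately show ?thesis by blast
  qed
  define \<pi> where "\<pi> = g \<circ> evens"
  have "Y \<subseteq> times_cube ?K"
    unfolding Y_def S0[symmetric] by blast
  then have evens_Y: "evens ` Y \<subseteq> ?K"
    using evens_times_cube[of ?K] by (metis image_mono)
  have lift_\<pi>: "\<exists>K'. subcontinuum (top_of_set Y) K' \<and> \<pi> ` K' = C" if C: "subcontinuum X C" for C
  proof -
    obtain K' where K': "subcontinuum (top_of_set Y) K'" "evens ` K' = f ` C"
      using lift_Y[OF C] by blast
    have "\<pi> ` K' = g ` f ` C" unfolding \<pi>_def image_comp[symmetric] K'(2) ..
    also have "\<dots> = (\<lambda>x. x) ` C"
      unfolding image_image using C g_f by (intro image_cong) (auto simp: subcontinuum_def)
    finally show ?thesis using K'(1) by auto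
  qed
  have \<pi>_cont: "continuous_map (top_of_set Y) X \<pi>"
    unfolding \<pi>_def
  proof (rule continuous_map_compose[OF _ g_cont])
    show "continuous_map (top_of_set Y) (top_of_set ?K) evens"
      using evens_Y continuous_on_evens by (auto simp: continuous_map_in_subtopology)
  qed
  have \<pi>_surj: "\<pi> ` topspace (top_of_set Y) = topspace X"
  proof
    show "\<pi> ` topspace (top_of_set Y) \<subseteq> topspace X"
      using \<pi>_cont by (simp add: continuous_map_def Pi_iff image_subset_iff)
    obtain K' where "subcontinuum (top_of_set Y) K'" "\<pi> ` K' = topspace X"
      using lift_\<pi>[OF X_sub] by blast
    then show "topspace X \<subseteq> \<pi> ` topspace (top_of_set Y)"
      by (auto simp: subcontinuum_top_of_set)
  qed
  have "\<not> covering_dim_le (top_of_set Y) 0"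
  proof -
    obtain K' where K': "K' \<subseteq> Y" "(\<lambda>y. y 1) ` K' = {0..1}"
      using lift_Y[OF X_sub] by (auto simp: subcontinuum_top_of_set)
    then have "0 \<in> (\<lambda>y. y 1) ` K'" "1 \<in> (\<lambda>y. y 1) ` K'" by simp_all
    then obtain a b where "a \<in> K'" "b \<in> K'" "a 1 = 0" "b 1 = 1" by auto
    then show ?thesis
      using K' Y(2) by (intro connected_not_covering_dim_le_0[of Y a b]) auto
  qed
  moreover have "covering_dim_le (top_of_set Y) 1"
    using res_Y Y(1) by (intro lines_imp_covering_dim_le_1) (auto simp: resolves_def)
  moreover have "hereditarily_indecomposable (top_of_set Y)"
    using res_Y Y by (intro folding_imp_hereditarily_indecomposable) (auto simp: resolves_def)
  ultimately have "continuum (top_of_set Y) \<and> one_dimensional (top_of_set Y) \<and>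
      hereditarily_indecomposable (top_of_set Y) \<and> second_countable (top_of_set Y) \<and>
      metrizable_space (top_of_set Y) \<and> continuous_map (top_of_set Y) X \<pi> \<and>
      \<pi> ` topspace (top_of_set Y) = topspace X \<and> weakly_confluent (top_of_set Y) X \<pi>"
    using Y \<pi>_cont \<pi>_surj lift_\<pi>
    by (simp add: one_dimensional_def continuum_top_of_set second_countable_top_of_set
        metrizable_space_subtopology metrizable_space_euclidean weakly_confluent_def)
  then show ?thesis by blast
qed

end
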